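(* For the speed-scaled Euclidean TSPD model with drone speed factor $\alpha\ge1$, $$\beta_{\mathsf{TSPD}}\;\ge\;\max\left\{\frac{5}{4(\alpha+2)},\ \frac{1}{e\sqrt{2\pi}}\right\}.$$
   Context: Traveling Salesman Problem with Drone (TSPD). Let $\|\cdot\|_T$ (truck metric) and $\|\cdot\|_D$ (drone metric) be norms on $\mathbb{R}^2$, and let $\mathcal X\subset\mathbb{R}^2$ be a finite set of customer points (nodes). In a solution each node is exactly one of: a truck node (visited only by the truck), a drone node (served only by the drone), or a combined node (visited by both vehicles; a synchronization point). A ring $r$ is given by two distinct combined nodes serving as start and end nodes, together with at most one drone node and any number (possibly zero) of truck nodes between them. In ring $r$ the truck follows a path $\mathcal T_r$ from the start node through all truck nodes of the ring (in some order) to the end node, and, if a drone node is present, the drone follows the path $\mathcal D_r$ from the start node to the drone node to the end node. With $t(\mathcal T_r)$ the sum of the $\|\cdot\|_T$-lengths of the edges of $\mathcal T_r$ and $d(\mathcal D_r)$ the sum of the $\|\cdot\|_D$-lengths of the edges of $\mathcal D_r$, the cost $c(r)$ of the ring is the minimum, over the choices of $\mathcal T_r,\mathcal D_r$, of $\max\{t(\mathcal T_r),d(\mathcal D_r)\}$ if the ring contains a drone node, and of $t(\mathcal T_r)$ otherwise. A feasible solution for $\mathcal X$ is a set $\mathcal R(\mathcal X)$ of rings that together cover all points of $\mathcal X$ and are concatenated through their combined nodes to form a single cyclic tour; each point of $\mathcal X$ is served exactly once: a combined node is shared by exactly two adjacent rings, and every other point belongs to exactly one ring. The optimal makespan is $\mathsf{TSPD}(\mathcal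 X)=\min_{\mathcal R(\mathcal X)}\sum_{r\in\mathcal R(\mathcal X)}c(r)$. Conventions: $\mathsf{TSPD}(\mathcal X)=0$ if $|\mathcal X|\le1$, and $\mathsf{TSPD}(\{x,y\})=2\|x-y\|_T$ for $x\ne y$. Speed-scaled Euclidean model: $\|p\|_T=\|p\|_2$ and $\|p\|_D=\frac1\alpha\|p\|_2$, where $\alpha\ge1$. Asymptotic constant: for $X_1,X_2,\ldots$ i.i.d. uniform on $[0,1]^2$, $\beta_{\mathsf{TSPD}}$ is the constant such that $\mathsf{TSPD}(\{X_1,\ldots,X_n\})/\sqrt n\to\beta_{\mathsf{TSPD}}$ almost surely and in expectation as $n\to\infty$ (this limit is known to exist). *)

theory Defs
  imports
    "HOL-Probability.Probability"
    "HOL-Combinatorics.Multiset_Permutations"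
begin

fun path_length :: "('a::ab_group_add \<Rightarrow> real) \<Rightarrow> 'a list \<Rightarrow> real" where
  "path_length N (x # y # zs) = N (y - x) + path_length N (y # zs)"
| "path_length N _ = 0"

(* A ring stores only its set of truck nodes; the order in which the truck visits them
   is optimised in the cost. *)
datatype 'a ring =
  Ring (start_node: 'a) (end_node: 'a) (drone_node: "'a option") (truck_nodes: "'a set")

definition inner_nodes :: "'a ring \<Rightarrow> 'a set" where
  "inner_nodes r = set_option (drone_node r) \<union> truck_nodes r"

definition valid_ring :: "'a ring \<Rightarrow> bool" where
  "valid_ring r \<longleftrightarrow>
     start_node r \<noteq> end_node r \<and>
     finite (truck_nodes r) \<and>
     set_option (drone_node r) \<inter> truck_nodes r = {} \<and>
     start_node r \<notin> inner_nodes r \<and> end_node r \<notin> inner_nodes r"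

definition ring_cost ::
    "('a::ab_group_add \<Rightarrow> real) \<Rightarrow> ('a \<Rightarrow> real) \<Rightarrow> 'a ring \<Rightarrow> real" where
  "ring_cost nT nD r =
     Min ((\<lambda>ts.
       let t = path_length nT (start_node r # ts @ [end_node r])
       in case drone_node r of
            None \<Rightarrow> t
          | Some v \<Rightarrow> max t (path_length nD [start_node r, v, end_node r]))
       ` permutations_of_set (truck_nodes r))"

(* The rings of R can be arranged in one cycle: each ring ends where its cyclic successor
   starts, and the start nodes are distinct, so that every combined node is shared by exactly
   two adjacent rings.  There are at least two rings, as start and end of a ring differ. *)
definition cyclic_tour :: "'a ring set \<Rightarrow> bool" where
  "cyclic_tour R \<longleftrightarrow>
     (\<exists>rs. rs \<noteq> [] \<and> distinct rs \<and> set rs = R \<and>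
        distinct (map start_node rs) \<and>
        (\<forall>i<length rs. end_node (rs ! i) = start_node (rs ! (Suc i mod length rs))))"

definition feasible :: "'a set \<Rightarrow> 'a ring set \<Rightarrow> bool" where
  "feasible X R \<longleftrightarrow>
     (\<forall>r\<in>R. valid_ring r) \<and>
     cyclic_tour R \<and>
     (\<forall>r\<in>R. \<forall>r'\<in>R. r \<noteq> r' \<longrightarrow> inner_nodes r \<inter> inner_nodes r' = {}) \<and>
     (\<forall>r\<in>R. inner_nodes r \<inter> start_node ` R = {}) \<and>
     start_node ` R \<union> (\<Union>r\<in>R. inner_nodes r) = X"

definition TSPD ::
    "('a::ab_group_add \<Rightarrow> real) \<Rightarrow> ('a \<Rightarrow> real) \<Rightarrow> 'a set \<Rightarrow> real" where
  "TSPD nT nD X =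
     (if card X \<le> 1 then 0
      else Min ((\<lambda>R. \<Sum>r\<in>R. ring_cost nT nD r) ` {R. feasible X R}))"

definition euclidean_TSPD :: "real \<Rightarrow> (real ^ 2) set \<Rightarrow> real" where
  "euclidean_TSPD \<alpha> = TSPD norm (\<lambda>p. norm p / \<alpha>)"

lemma end_nodes_eq_start_nodes:
  assumes "cyclic_tour R"
  shows "end_node ` R = start_node ` R"
proof -
  obtain rs where rs: "rs \<noteq> []" "set rs = R"
    and e: "\<And>i. i < length rs \<Longrightarrow> end_node (rs ! i) = start_node (rs ! (Suc i mod length rs))"
    using assms unfolding cyclic_tour_def by blast
  let ?n = "length rs"
  have n: "?n > 0" using rs by simp
  have R: "R = (!) rs ` {..<?n}"
    using rs by (auto simp: set_conv_nth)
  have succ: "(\<lambda>i. Suc i mod ?n) ` {..<?n} = {..<?n}"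
  proof (rule antisym)
    show "{..<?n} \<subseteq> (\<lambda>i. Suc i mod ?n) ` {..<?n}"
    proof
      fix j assume j: "j \<in> {..<?n}"
      show "j \<in> (\<lambda>i. Suc i mod ?n) ` {..<?n}"
      proof (cases j)
        case 0
        then show ?thesis using n by (intro image_eqI[of _ _ "?n - 1"]) auto
      next
        case (Suc k)
        then show ?thesis using j by (intro image_eqI[of _ _ k]) auto
      qed
    qed
  qed (use n in auto)
  have "end_node ` R = (\<lambda>j. start_node (rs ! j)) ` (\<lambda>i. Suc i mod ?n) ` {..<?n}"
    unfolding R image_image by (intro image_cong) (use e in auto)
  also have "\<dots> = start_node ` R"
    unfolding succ by (simp add: R image_image)
  finally show ?thesis .
qed

lemma finite_feasible:
  assumes "finite X"
  shows "finite {R. feasible X R}"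
proof -
  let ?B = "(\<lambda>(a, b, d, T). Ring a b d T) ` (X \<times> X \<times> insert None (Some ` X) \<times> Pow X)"
  have "R \<subseteq> ?B" if F: "feasible X R" for R
  proof
    fix r assume r: "r \<in> R"
    have e: "end_node ` R = start_node ` R"
      using F end_nodes_eq_start_nodes by (auto simp: feasible_def)
    have X: "X = start_node ` R \<union> (\<Union>r\<in>R. inner_nodes r)"
      using F by (simp add: feasible_def)
    have "end_node r \<in> start_node ` R" using r e by blast
    then have "start_node r \<in> X" "end_node r \<in> X" "inner_nodes r \<subseteq> X"
      unfolding X using r by auto
    then show "r \<in> ?B"
      by (cases r; cases "drone_node r") (auto simp: inner_nodes_def image_iff)
  qed
  then have "{R. feasible X R} \<subseteq> Pow ?B" by blast
  moreover have "finite ?B" using assms by simp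
  ultimately show ?thesis using finite_subset by blast
qed

lemma ex_feasible:
  assumes "finite X" "card X \<ge> 2"
  shows "\<exists>R. feasible X R"
proof -
  obtain xs where xs: "set xs = X" "distinct xs"
    using finite_distinct_list[OF assms(1)] by blast
  let ?n = "length xs"
  have n: "?n \<ge> 2" using assms xs distinct_card by metis
  define f where "f i = Ring (xs ! i) (xs ! (Suc i mod ?n)) None {}" for i
  define rs where "rs = map f [0..<?n]"
  have starts: "map start_node rs = xs"
    by (simp add: rs_def f_def comp_def map_nth)
  have ne: "xs ! i \<noteq> xs ! (Suc i mod ?n)" if "i < ?n" for i
  proof -
    have "Suc i mod ?n \<noteq> i"
      using that n by (cases "Suc i = ?n") auto
    then show ?thesis
      using that n xs(2) by (metis mod_less_divisor nth_eq_iff_index_eq order.strict_trans2 zero_less_numeral)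
  qed
  have "valid_ring r" "inner_nodes r = {}" if "r \<in> set rs" for r
    using that ne by (auto simp: rs_def f_def valid_ring_def inner_nodes_def)
  moreover have "cyclic_tour (set rs)"
    unfolding cyclic_tour_def
  proof (intro exI[of _ rs] conjI allI impI)
    show "distinct rs" "distinct (map start_node rs)"
      using starts xs(2) distinct_map by metis+
    show "rs \<noteq> []" using n by (auto simp: rs_def)
    fix i assume i: "i < length rs"
    have "length rs = ?n" by (simp add: rs_def)
    moreover have "Suc i mod ?n < ?n" using n by (intro mod_less_divisor) auto
    ultimately show "end_node (rs ! i) = start_node (rs ! (Suc i mod length rs))"
      using i by (simp add: rs_def f_def)
  qed simp
  moreover have "start_node ` set rs = X"
    using starts xs(1) by (metis set_map)
  ultimately have "feasible X (set rs)"
    by (auto simp: feasible_def)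
  then show ?thesis ..
qed

lemma feasible_pair:
  assumes "x \<noteq> y"
  shows "feasible {x, y} R \<longleftrightarrow> R = {Ring x y None {}, Ring y x None {}}"
proof
  assume F: "feasible {x, y} R"
  then have e: "end_node ` R = start_node ` R"
    using end_nodes_eq_start_nodes by (auto simp: feasible_def)
  obtain rs where rs: "rs \<noteq> []" "set rs = R" "distinct (map start_node rs)"
  proof -
    have "cyclic_tour R" using F by (simp add: feasible_def)
    then show ?thesis using that unfolding cyclic_tour_def by blast
  qed
  have inj: "inj_on start_node R" using rs(2,3) by (simp add: distinct_map)
  have X: "{x, y} = start_node ` R \<union> (\<Union>r\<in>R. inner_nodes r)"
    using F by (simp add: feasible_def)
  have v: "start_node r \<noteq> end_node r" "start_node r \<in> {x, y}" "end_node r \<in> {x, y}"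
    if r: "r \<in> R" for r
  proof -
    show "start_node r \<noteq> end_node r"
      using F r by (simp add: feasible_def valid_ring_def)
    have "end_node r \<in> start_node ` R" using r e by blast
    then show "start_node r \<in> {x, y}" "end_node r \<in> {x, y}"
      unfolding X using r by auto
  qed
  obtain r where "r \<in> R" using rs by (cases rs) auto
  then have "{start_node r, end_node r} \<subseteq> start_node ` R" "{start_node r, end_node r} = {x, y}"
    using e v[of r] by auto
  moreover have "start_node ` R \<subseteq> {x, y}" using v(2) by blast
  ultimately have S: "start_node ` R = {x, y}" by blast
  have inner: "inner_nodes r = {}" if "r \<in> R" for r
  proof -
    have "inner_nodes r \<inter> {x, y} = {}"
      using F that by (simp add: feasible_def S)
    moreover have "inner_nodes r \<subseteq> {x, y}" unfolding X using that by blast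
    ultimately show ?thesis by blast
  qed
  have form: "r = Ring (start_node r) (end_node r) None {}" if "r \<in> R" for r
    using inner[OF that] by (cases r) (auto simp: inner_nodes_def)
  obtain r1 r2 where r12: "r1 \<in> R" "start_node r1 = x" "r2 \<in> R" "start_node r2 = y"
    using S by (metis imageE insertI1 insertI2)
  have "end_node r1 = y" "end_node r2 = x"
    using v[OF r12(1)] v[OF r12(3)] r12 by auto
  then have "r1 = Ring x y None {}" "r2 = Ring y x None {}"
    using form[OF r12(1)] form[OF r12(3)] r12 by simp_all
  moreover have "R = {r1, r2}"
  proof -
    have "r = r1 \<or> r = r2" if "r \<in> R" for r
      using v(2)[OF that] inj_onD[OF inj _ that r12(1)] inj_onD[OF inj _ that r12(3)] r12(2,4)
      by auto
    then show ?thesis using r12(1,3) by blast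
  qed
  ultimately show "R = {Ring x y None {}, Ring y x None {}}" by simp
next
  assume R: "R = {Ring x y None {}, Ring y x None {}}"
  have "cyclic_tour R"
    unfolding cyclic_tour_def R using assms
    by (intro exI[of _ "[Ring x y None {}, Ring y x None {}]"]) (auto simp: less_Suc_eq nth_Cons')
  then show "feasible {x, y} R"
    using assms by (auto simp: feasible_def R valid_ring_def inner_nodes_def)
qed

lemma TSPD_pair:
  assumes "x \<noteq> y" "nT (x - y) = nT (y - x)"
  shows "TSPD nT nD {x, y} = 2 * nT (x - y)"
proof -
  have "{R. feasible {x, y} R} = {{Ring x y None {}, Ring y x None {}}}"
    using feasible_pair[OF assms(1)] by blast
  then show ?thesis
    using assms by (simp add: TSPD_def ring_cost_def)
qed

end

theory Submission
  imports Defs "HOL-Real_Asymp.Real_Asymp"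
begin

text \<open>
  First bound. In a solution every node is joined to two distinct other nodes, by truck edges or, for a
  drone node, by drone edges. Charging truck edges to both endpoints and drone edges to the drone node
  only, the sum over all nodes of the distances to the two nearest neighbours is at most twice the
  truck length plus the drone length, hence at most \<open>\<alpha> + 2\<close> times the makespan. For \<open>n\<close> uniform points
  that sum is about \<open>5/4 sqrt n\<close>. The two distances are never formed: each is replaced by a
  Riemann sum over the radius of the indicator that it exceeds the radius, truncated to stay bounded.

  Second bound. Each ring has at most one drone node, so the truck visits at least half of the points
  and the makespan is at least the length of a path through \<open>k = \<lceil>n/2\<rceil>\<close> of them. Since
  \<open>exp (- s \<bar>u\<bar>)\<close> integrates to \<open>2\<pi>/s\<^sup>2\<close> over the plane, the expected sum of \<open>exp (- s L)\<close> over all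
  such paths is at most \<open>n\<^sup>k (2\<pi>/s\<^sup>2)\<^sup>k\<^sup>-\<^sup>1\<close>. With \<open>s = e sqrt (2\<pi> n)\<close> this is
  at most \<open>n exp (2 - n)\<close>, which excludes paths of length \<open>c sqrt n\<close> for \<open>c < 1 / (e sqrt (2\<pi>))\<close>.
\<close>

subsection \<open>Truck tours\<close>

lemma path_length_append:
  "path_length N (xs @ y # ys) = path_length N (xs @ [y]) + path_length N (y # ys)"
proof (induction xs)
  case (Cons x xs)
  then show ?case by (cases xs) auto
qed simp

lemma path_length_conv_sum:
  "path_length N xs = (\<Sum>i<length xs - 1. N (xs ! Suc i - xs ! i))"
proof (induction N xs rule: path_length.induct)
  case (1 N x y zs)
  then show ?case by (simp add: sum.lessThan_Suc_shift del: sum.lessThan_Suc)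
qed auto

lemma path_length_nonneg:
  assumes "\<And>v. N v \<ge> 0"
  shows "path_length N xs \<ge> 0"
  unfolding path_length_conv_sum using assms by (intro sum_nonneg) auto

lemma path_length_take_le:
  assumes "\<And>v. N v \<ge> 0"
  shows "path_length N (take k xs) \<le> path_length N xs"
proof (cases "drop k xs")
  case Nil
  then show ?thesis by simp
next
  case (Cons y ys)
  have le: "path_length N zs \<le> path_length N (zs @ [y])" for zs
    using assms path_length_append[of N _ _ "[y]"] by (cases zs rule: rev_cases) auto
  have "path_length N xs = path_length N (take k xs @ [y]) + path_length N (y # ys)"
    using Cons append_take_drop_id[of k xs] path_length_append by metis
  then show ?thesis
    using le[of "take k xs"] path_length_nonneg[of N "y # ys", OF assms] by linarith
qed

lemma bij_betw_Suc_mod: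
  assumes "m > 0"
  shows "bij_betw (\<lambda>i. Suc i mod m) {..<m} {..<m}"
proof -
  have "inj_on (\<lambda>i. Suc i mod m) {..<m}"
  proof (rule inj_onI)
    fix i j assume "i \<in> {..<m}" "j \<in> {..<m}" "Suc i mod m = Suc j mod m"
    then show "i = j" by (cases "Suc i = m"; cases "Suc j = m") auto
  qed
  moreover have "(\<lambda>i. Suc i mod m) ` {..<m} \<subseteq> {..<m}"
    using assms by auto
  ultimately show ?thesis
    by (simp add: bij_betw_def endo_inj_surj)
qed

lemma closed_path_length_conv_sum:
  assumes "p \<noteq> []"
  shows "path_length N (p @ [hd p]) = (\<Sum>i<length p. N (p ! (Suc i mod length p) - p ! i))"
proof -
  have "(p @ [hd p]) ! Suc i = p ! (Suc i mod length p)" if "i < length p" for i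
    using that assms by (cases "Suc i = length p") (auto simp: nth_append hd_conv_nth)
  then show ?thesis
    unfolding path_length_conv_sum by (intro sum.cong) (auto simp: nth_append)
qed

text \<open>With only two vertices the two tour neighbours of a vertex would coincide.\<close>

lemma sum_le_closed_path_length:
  fixes p :: "'a::real_normed_vector list"
  assumes "distinct p" "length p \<ge> 3"
    and \<psi>: "\<And>v a b. {v, a, b} \<subseteq> set p \<Longrightarrow> distinct [v, a, b] \<Longrightarrow> \<psi> v \<le> norm (a - v) + norm (b - v)"
  shows "sum \<psi> (set p) \<le> 2 * path_length norm (p @ [hd p])"
proof -
  define m where "m = length p"
  define s where "s i = Suc i mod m" for i
  have m: "m \<ge> 3" and p: "p \<noteq> []" using assms(2) by (auto simp: m_def)
  have s: "bij_betw s {..<m} {..<m}"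
    using bij_betw_Suc_mod[of m] m by (simp add: s_def[abs_def])
  have len: "path_length norm (p @ [hd p]) = (\<Sum>i<m. norm (p ! s i - p ! i))"
    using closed_path_length_conv_sum[OF p] by (simp add: m_def s_def)
  have "sum \<psi> (set p) = (\<Sum>i<m. \<psi> (p ! i))"
    using assms(1) sum.reindex_bij_betw[OF bij_betw_nth[of p "{..<m}" "set p"]]
    by (metis m_def)
  \<comment> \<open>Shifting the index by one makes \<open>i\<close> the predecessor and
    \<open>s (s i)\<close> the successor of the vertex \<open>s i\<close>, so no predecessor
    function is needed. Undoing the shift afterwards shows that every edge is counted twice.\<close>
  also have "\<dots> = (\<Sum>i<m. \<psi> (p ! s i))"
    by (rule sum.reindex_bij_betw[OF s, of "\<lambda>i. \<psi> (p ! i)", symmetric])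
  also have "\<dots> \<le> (\<Sum>i<m. norm (p ! s i - p ! i) + norm (p ! s (s i) - p ! s i))"
  proof (rule sum_mono)
    fix i assume "i \<in> {..<m}"
    then have i: "i < m" "s i < m" "s (s i) < m" using m by (auto simp: s_def)
      have "s j \<noteq> j" if "j < m" for j
      using that m by (cases "Suc j = m") (auto simp: s_def)
    note this[OF i(1)] this[OF i(2)]
    moreover have "s (s i) \<noteq> i"
      using i(1) m by (cases "Suc i = m"; cases "Suc (Suc i) = m") (auto simp: s_def)
    ultimately have "distinct [p ! s i, p ! i, p ! s (s i)]"
      using i assms(1) by (auto simp: m_def nth_eq_iff_index_eq)
    then have "\<psi> (p ! s i) \<le> norm (p ! i - p ! s i) + norm (p ! s (s i) - p ! s i)"
      using i by (intro \<psi>) (auto simp: m_def)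
    then show "\<psi> (p ! s i) \<le> norm (p ! s i - p ! i) + norm (p ! s (s i) - p ! s i)"
      by (simp add: norm_minus_commute)
  qed
  also have "\<dots> = 2 * path_length norm (p @ [hd p])"
    using sum.reindex_bij_betw[OF s, of "\<lambda>i. norm (p ! s i - p ! i)"]
    by (simp add: sum.distrib len)
  finally show ?thesis .
qed

section \<open>From a set of rings to one closed truck tour\<close>

text \<open>At an order attaining the minimum, the cost is the truck length or the larger of truck
  and drone length, so the same list satisfies both inequalities.\<close>

lemma ring_cost_attained:
  assumes "finite (truck_nodes r)"
  obtains ts where "distinct ts" "set ts = truck_nodes r"
    "path_length nT (start_node r # ts @ [end_node r]) \<le> ring_cost nT nD r"
    "\<And>v. drone_node r = Some v \<Longrightarrow>
       path_length nD [start_node r, v, end_node r] \<le> ring_cost nT nD r"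
proof -
  let ?c = "\<lambda>ts. let t = path_length nT (start_node r # ts @ [end_node r])
       in case drone_node r of None \<Rightarrow> t
          | Some v \<Rightarrow> max t (path_length nD [start_node r, v, end_node r])"
  have "ring_cost nT nD r \<in> ?c ` permutations_of_set (truck_nodes r)"
    unfolding ring_cost_def using assms by (intro Min_in) auto
  then obtain ts where "ts \<in> permutations_of_set (truck_nodes r)" "ring_cost nT nD r = ?c ts"
    by auto
  then show ?thesis
    by (intro that[of ts]) (auto simp: permutations_of_set_def Let_def split: option.splits)
qed

text \<open>Meant for rings in cyclic order: a block \<open>g r\<close> omits the end node of
  \<open>r\<close>, which reappears as the first node of the next block. Only the last end node has
  to be appended.\<close>

lemma path_length_concat:
  assumes "rs \<noteq> []" "\<And>r. r \<in> set rs \<Longrightarrow> hd (g r) = a r \<and> g r \<noteq> []"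
    and "\<And>i. Suc i < length rs \<Longrightarrow> b (rs ! i) = a (rs ! Suc i)"
  shows "path_length N (concat (map g rs) @ [b (last rs)]) =
    (\<Sum>r\<leftarrow>rs. path_length N (g r @ [b r]))"
  using assms
proof (induction rs)
  case (Cons r rs)
  show ?case
  proof (cases rs)
    case (Cons r' rs')
    have IH: "path_length N (concat (map g rs) @ [b (last rs)]) =
        (\<Sum>r\<leftarrow>rs. path_length N (g r @ [b r]))"
      using Cons.prems Cons by (intro Cons.IH) force+
    have "b r = a r'" using Cons.prems(3)[of 0] Cons by simp
    moreover have "hd (g r') = a r'" "g r' \<noteq> []" using Cons.prems(2) Cons by auto
    ultimately obtain ys where "concat (map g rs) = b r # ys"
      using Cons by (cases "g r'") auto
    then show ?thesis
      using IH path_length_append[of N "g r" "b r" "ys @ [b (last rs)]"] Cons by simp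
  qed simp
qed simp

text \<open>The optimal truck paths of the rings, joined in cyclic order, form one closed tour
  through all nodes not served by the drone. Each ring puts its own start node on this tour and
  leaves at most one drone node off it, so the tour visits at least half of
  \<open>X\<close>.\<close>

lemma feasible_truck_tour:
  fixes nT nD :: "'a::ab_group_add \<Rightarrow> real"
  assumes F: "feasible X R" and fin: "finite X"
  obtains p where "distinct p" "p \<noteq> []" "set p = X - (\<Union>r\<in>R. set_option (drone_node r))"
    "path_length nT (p @ [hd p]) \<le> (\<Sum>r\<in>R. ring_cost nT nD r)" "card X \<le> 2 * length p"
proof -
  have vr: "valid_ring r" if "r \<in> R" for r using F that by (auto simp: feasible_def)
  obtain rs where rs: "rs \<noteq> []" "distinct rs" "set rs = R" "distinct (map start_node rs)"
    and en: "\<And>i. i < length rs \<Longrightarrow> end_node (rs ! i) = start_node (rs ! (Suc i mod length rs))"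
  proof -
    have "cyclic_tour R" using F by (simp add: feasible_def)
    then show ?thesis using that unfolding cyclic_tour_def by blast
  qed
  have inj: "inj_on start_node R" using rs by (simp add: distinct_map)
  have dj: "inner_nodes r \<inter> inner_nodes r' = {}" if "r \<in> R" "r' \<in> R" "r \<noteq> r'" for r r'
    using F that by (auto simp: feasible_def)
  have st: "inner_nodes r \<inter> start_node ` R = {}" if "r \<in> R" for r
    using F that by (auto simp: feasible_def)
  have X: "X = start_node ` R \<union> (\<Union>r\<in>R. inner_nodes r)"
    using F by (simp add: feasible_def)
  have "\<forall>r\<in>R. \<exists>ts. distinct ts \<and> set ts = truck_nodes r \<and>
     path_length nT (start_node r # ts @ [end_node r]) \<le> ring_cost nT nD r"
    using vr ring_cost_attained unfolding valid_ring_def by metis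
  then obtain ts where ts: "\<And>r. r \<in> R \<Longrightarrow> distinct (ts r)" "\<And>r. r \<in> R \<Longrightarrow> set (ts r) = truck_nodes r"
     "\<And>r. r \<in> R \<Longrightarrow> path_length nT (start_node r # ts r @ [end_node r]) \<le> ring_cost nT nD r"
    by metis
  define g where "g r = start_node r # ts r" for r
  define p where "p = concat (map g rs)"
  have setg: "set (g r) = insert (start_node r) (truck_nodes r)" if "r \<in> R" for r
    using ts(2)[OF that] by (simp add: g_def)
  have disj: "set (g r) \<inter> set (g r') = {}" if "r \<in> R" "r' \<in> R" "r \<noteq> r'" for r r'
    using that dj[OF that] st[of r] st[of r'] inj_onD[OF inj, of r r']
    by (auto simp: setg inner_nodes_def)
  have "distinct (g r)" if "r \<in> R" for r
    using that ts st[OF that] by (auto simp: g_def inner_nodes_def)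
  moreover have "inj_on g R"
    using inj by (auto simp: inj_on_def g_def)
  ultimately have "distinct p"
    unfolding p_def using rs disj by (intro distinct_concat) (auto simp: distinct_map)
  moreover have "p \<noteq> []" using rs(1) by (cases rs) (auto simp: p_def g_def)
  moreover have setp: "set p = X - (\<Union>r\<in>R. set_option (drone_node r))"
  proof -
    have "set p = start_node ` R \<union> (\<Union>r\<in>R. truck_nodes r)"
      using rs(3) setg by (auto simp: p_def)
    moreover have "drone_node r = Some v \<Longrightarrow> r \<in> R \<Longrightarrow> r' \<in> R \<Longrightarrow> v \<notin> truck_nodes r'" for v r r'
      using dj[of r r'] vr[of r] by (cases "r = r'") (auto simp: inner_nodes_def valid_ring_def)
    moreover have "drone_node r = Some v \<Longrightarrow> r \<in> R \<Longrightarrow> v \<notin> start_node ` R" for v r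
      using st[of r] by (auto simp: inner_nodes_def)
    ultimately show ?thesis
      unfolding X by (force simp: inner_nodes_def)
  qed
  moreover have "path_length nT (p @ [hd p]) \<le> (\<Sum>r\<in>R. ring_cost nT nD r)"
  proof -
    have "hd p = start_node (rs ! 0)" using rs(1) by (cases rs) (auto simp: p_def g_def)
    \<comment> \<open>The successor index of the last ring wraps around to 0, which closes the
      tour.\<close>
    also have "\<dots> = end_node (last rs)"
      using en[of "length rs - 1"] rs(1) by (simp add: last_conv_nth)
    finally have "path_length nT (p @ [hd p]) = (\<Sum>r\<leftarrow>rs. path_length nT (g r @ [end_node r]))"
      unfolding p_def
      using path_length_concat[of rs g start_node end_node nT] rs(1) en by (simp add: g_def)
    also have "\<dots> = (\<Sum>r\<in>R. path_length nT (g r @ [end_node r]))"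
      using rs by (simp add: sum_list_distinct_conv_sum_set)
    also have "\<dots> \<le> (\<Sum>r\<in>R. ring_cost nT nD r)"
      using ts by (intro sum_mono) (simp add: g_def)
    finally show ?thesis .
  qed
  moreover have "card X \<le> 2 * length p"
  proof -
    have "finite R" using rs by auto
    have "start_node ` R \<subseteq> set p" using rs(3) by (auto simp: p_def g_def)
    then have "card R \<le> card (set p)" using inj by (metis List.finite_set card_image card_mono)
    then have R: "card R \<le> length p" using card_length le_trans by blast
    have "card X \<le> card (set p \<union> (\<Union>r\<in>R. set_option (drone_node r)))"
      using fin by (intro card_mono finite_subset[OF _ fin, of "_ \<union> _"]) (auto simp: setp X inner_nodes_def)
    also have "\<dots> \<le> card (set p) + card (\<Union>r\<in>R. set_option (drone_node r))"
      by (rule card_Un_le)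
    also have "card (\<Union>r\<in>R. set_option (drone_node r)) \<le> (\<Sum>r\<in>R. card (set_option (drone_node r)))"
      using \<open>finite R\<close> by (rule card_UN_le)
    also have "\<dots> \<le> (\<Sum>r\<in>R. 1)"
    proof (rule sum_mono)
      show "card (set_option (drone_node r)) \<le> 1" for r :: "'a ring"
        by (cases "drone_node r") auto
    qed
    finally show ?thesis using R card_length[of p] by simp
  qed
  ultimately show ?thesis using that by blast
qed

lemma TSPD_attained:
  assumes "finite X" "card X \<ge> 2"
  obtains R where "feasible X R" "TSPD nT nD X = (\<Sum>r\<in>R. ring_cost nT nD r)"
proof -
  have "TSPD nT nD X = Min ((\<lambda>R. \<Sum>r\<in>R. ring_cost nT nD r) ` {R. feasible X R})"
    using assms by (simp add: TSPD_def)
  also have "\<dots> \<in> (\<lambda>R. \<Sum>r\<in>R. ring_cost nT nD r) ` {R. feasible X R}"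
    using finite_feasible[OF assms(1)] ex_feasible[OF assms] by (intro Min_in) auto
  finally show ?thesis using that by auto
qed

text \<open>The truck tour of an optimal solution visits at least half of the points, and cutting it
  after \<open>k\<close> nodes only removes nonnegative edges. The \<open>Suc\<close> admits half of
  the cardinality rounded up.\<close>

lemma TSPD_ge_half_path:
  fixes nT nD :: "'a::ab_group_add \<Rightarrow> real"
  assumes "finite X" "card X \<ge> 2" "2 * k \<le> Suc (card X)" and "\<And>v. nT v \<ge> 0"
  obtains q where "distinct q" "length q = k" "set q \<subseteq> X" "path_length nT q \<le> TSPD nT nD X"
proof -
  obtain R where R: "feasible X R" "TSPD nT nD X = (\<Sum>r\<in>R. ring_cost nT nD r)"
    using TSPD_attained[OF assms(1,2)] by blast
  obtain p where p: "distinct p" "p \<noteq> []" "set p \<subseteq> X"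
    "path_length nT (p @ [hd p]) \<le> TSPD nT nD X" "card X \<le> 2 * length p"
    using feasible_truck_tour[OF R(1) assms(1), of nT nD] R(2) by (metis Diff_subset)
  have k: "k \<le> length p" using p(5) assms(3) by simp
  show ?thesis
  proof
    show "path_length nT (take k p) \<le> TSPD nT nD X"
      using path_length_take_le[of nT k "p @ [hd p]"] assms(4) p(4) k by simp
    show "set (take k p) \<subseteq> X" using p(3) set_take_subset by fastforce
  qed (use p k in auto)
qed

text \<open>A node on the truck tour pays with its two tour edges, which costs twice the makespan in
  total. A drone node pays with the drone path of its ring, whose Euclidean length is at most
  \<alpha> times the ring cost. Five points ensure at least three nodes on the truck tour, so that
  the two tour neighbours differ.\<close>

lemma euclidean_TSPD_ge_neighbour_sum:
  assumes \<alpha>: "\<alpha> > 0" and X: "finite X" "card X \<ge> 5"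
    and \<psi>: "\<And>v a b. {v, a, b} \<subseteq> X \<Longrightarrow> distinct [v, a, b] \<Longrightarrow> \<psi> v \<le> norm (a - v) + norm (b - v)"
  shows "sum \<psi> X \<le> (\<alpha> + 2) * euclidean_TSPD \<alpha> X"
proof -
  let ?c = "ring_cost norm (\<lambda>p. norm p / \<alpha>) :: (real^2) ring \<Rightarrow> real"
  obtain R where F: "feasible X R" and R: "euclidean_TSPD \<alpha> X = (\<Sum>r\<in>R. ?c r)"
  proof -
    have "card X \<ge> 2" using X(2) by simp
    then show ?thesis
      using that TSPD_attained[OF X(1)] unfolding euclidean_TSPD_def by metis
  qed
  obtain p where p: "distinct p" "p \<noteq> []" "set p = X - (\<Union>r\<in>R. set_option (drone_node r))"
    "path_length norm (p @ [hd p]) \<le> (\<Sum>r\<in>R. ?c r)" "card X \<le> 2 * length p"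
    using feasible_truck_tour[OF F X(1)] by metis
  let ?D = "\<Union>r\<in>R. set_option (drone_node r)"
  have "finite R" using F by (auto simp: feasible_def cyclic_tour_def)
  have DX: "?D \<subseteq> X" using F by (auto simp: feasible_def inner_nodes_def)
  have e: "end_node ` R = start_node ` R"
    using F end_nodes_eq_start_nodes by (auto simp: feasible_def)
  have drone: "\<psi> v \<le> \<alpha> * ?c r" if r: "r \<in> R" and v: "drone_node r = Some v" for r v
  proof -
    have vr: "valid_ring r" using F r by (auto simp: feasible_def)
    have "end_node r \<in> start_node ` R" using r e by blast
    then have "{v, start_node r, end_node r} \<subseteq> X"
      using F r v by (auto simp: feasible_def inner_nodes_def)
    moreover have "distinct [v, start_node r, end_node r]"
      using vr v by (auto simp: valid_ring_def inner_nodes_def)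
    ultimately have "\<psi> v \<le> norm (start_node r - v) + norm (end_node r - v)"
      by (rule \<psi>)
    also have "\<dots> = \<alpha> * path_length (\<lambda>p. norm p / \<alpha>) [start_node r, v, end_node r]"
      using \<alpha> by (simp add: norm_minus_commute field_simps)
    also have "\<dots> \<le> \<alpha> * ?c r"
      using \<alpha> vr v ring_cost_attained[of r norm "\<lambda>p. norm p / \<alpha>"]
      by (intro mult_left_mono) (auto simp: valid_ring_def)
    finally show ?thesis .
  qed
  \<comment> \<open>Needed for the rings without a drone node, whose share of the drone sum is
    0.\<close>
  have c0: "0 \<le> ?c r" if r: "r \<in> R" for r
  proof -
    have "finite (truck_nodes r)" using F r by (auto simp: feasible_def valid_ring_def)
    then obtain ts where "path_length norm (start_node r # ts @ [end_node r]) \<le> ?c r"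
      using ring_cost_attained by metis
    then show ?thesis using path_length_nonneg[of norm] by (meson norm_ge_zero order_trans)
  qed
  have "sum \<psi> ?D = (\<Sum>r\<in>R. sum \<psi> (set_option (drone_node r)))"
  proof (rule sum.UNION_disjoint)
    show "\<forall>r\<in>R. \<forall>r'\<in>R. r \<noteq> r' \<longrightarrow> set_option (drone_node r) \<inter> set_option (drone_node r') = {}"
      using F unfolding feasible_def inner_nodes_def by blast
  qed (use \<open>finite R\<close> in auto)
  also have "\<dots> \<le> (\<Sum>r\<in>R. \<alpha> * ?c r)"
  proof (rule sum_mono)
    fix r assume r: "r \<in> R"
    then show "sum \<psi> (set_option (drone_node r)) \<le> \<alpha> * ?c r"
      using drone[OF r] c0[OF r] \<alpha> by (cases "drone_node r") auto
  qed
  finally have D: "sum \<psi> ?D \<le> \<alpha> * euclidean_TSPD \<alpha> X"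
    by (simp add: R sum_distrib_left)
  have "sum \<psi> (set p) \<le> 2 * path_length norm (p @ [hd p])"
    using p X by (intro sum_le_closed_path_length \<psi>) auto
  then have P: "sum \<psi> (set p) \<le> 2 * euclidean_TSPD \<alpha> X"
    using p(4) R by simp
  have "sum \<psi> X = sum \<psi> (X - ?D) + sum \<psi> ?D"
    using sum.subset_diff[OF DX X(1)] .
  then show ?thesis using P D p(3) by (simp add: algebra_simps)
qed

subsection \<open>Uniform points in the unit square\<close>

text \<open>Layer-cake argument: \<open>exp (- s * a)\<close> is the integral of
  \<open>s * exp (- s * r)\<close> over \<open>r \<ge> a\<close>. Exchanging the integrals turns the
  plane integral into one over disc areas \<open>pi * r\<^sup>2\<close>.\<close>

lemma nn_integral_exp_dist:
  fixes v :: "real ^ 2"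
  assumes "s > 0"
  shows "(\<integral>\<^sup>+u. ennreal (exp (- s * dist v u)) \<partial>lborel) = ennreal (2 * pi / s\<^sup>2)"
proof -
  have tail: "ennreal (exp (- s * a)) = (\<integral>\<^sup>+r. ennreal (s * exp (- s * r)) * indicator {a..} r \<partial>lborel)" for a
  proof -
    have "((\<lambda>r. - exp (- s * r)) \<longlongrightarrow> 0) at_top"
      using assms by real_asymp
    moreover have "((\<lambda>r. - exp (- s * r)) has_real_derivative s * exp (- s * r)) (at r)" for r
      by (auto intro!: derivative_eq_intros)
    ultimately show ?thesis
      using assms by (subst nn_integral_FTC_atLeast[where F = "\<lambda>r. - exp (- s * r)" and T = 0]) auto
  qed
  have "(\<integral>\<^sup>+u. ennreal (exp (- s * dist v u)) \<partial>lborel) =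
      (\<integral>\<^sup>+u. \<integral>\<^sup>+r. ennreal (s * exp (- s * r)) * indicator {..r} (dist v u) \<partial>lborel \<partial>lborel)"
    by (subst tail) (intro nn_integral_cong, auto simp: indicator_def)
  also have "\<dots> = (\<integral>\<^sup>+r. \<integral>\<^sup>+u. ennreal (s * exp (- s * r)) * indicator {..r} (dist v u) \<partial>lborel \<partial>lborel)"
  proof (rule pair_sigma_finite.Fubini')
    show "pair_sigma_finite (lborel :: real measure) (lborel :: (real ^ 2) measure)"
      by (intro pair_sigma_finite.intro lborel.sigma_finite_measure_axioms)
   
    have "(\<lambda>(r, u). ennreal (s * exp (- s * r)) * indicator {x. dist v (snd x) \<le> fst x} (r, u))
        \<in> borel_measurable (lborel \<Otimes>\<^sub>M lborel)"
      by measurable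
    also have "(\<lambda>(r, u). ennreal (s * exp (- s * r)) * indicator {x. dist v (snd x) \<le> fst x} (r, u)) =
        (\<lambda>(r, u). ennreal (s * exp (- s * r)) * indicator {..r} (dist v u))"
      by (auto simp: indicator_def)
    finally show "(\<lambda>(r, u). ennreal (s * exp (- s * r)) * indicator {..r} (dist v u))
        \<in> borel_measurable (lborel \<Otimes>\<^sub>M lborel)" .
  qed
  also have "\<dots> = (\<integral>\<^sup>+r. ennreal (s * pi * r\<^sup>2 * exp (- s * r)) * indicator {0..} r \<partial>lborel)"
  proof (rule nn_integral_cong)
    fix r :: real
    have "(\<integral>\<^sup>+u. ennreal (s * exp (- s * r)) * indicator {..r} (dist v u) \<partial>lborel) =
        (\<integral>\<^sup>+u. ennreal (s * exp (- s * r)) * indicator (cball v r) u \<partial>lborel)"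
      by (intro nn_integral_cong) (auto simp: indicator_def)
    also have "\<dots> = ennreal (s * exp (- s * r)) * emeasure lborel (cball v r)"
      by (rule nn_integral_cmult_indicator) auto
    also have "\<dots> = ennreal (s * pi * r\<^sup>2 * exp (- s * r)) * indicator {0..} r"
    proof (cases "r \<ge> 0")
      case True
      then show ?thesis
        using assms by (simp add: emeasure_cball unit_ball_vol_2 ennreal_mult'[symmetric] mult_ac)
    qed auto
    finally show "(\<integral>\<^sup>+u. ennreal (s * exp (- s * r)) * indicator {..r} (dist v u) \<partial>lborel) = \<dots>" .
  qed
  \<comment> \<open>The primitive comes from integrating by parts twice.\<close>
  also have "\<dots> = ennreal (0 - (- pi * exp (- s * 0) * (0\<^sup>2 + 2 * 0 / s + 2 / s\<^sup>2)))"
  proof (rule nn_integral_FTC_atLeast)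
    show "((\<lambda>r. - pi * exp (- s * r) * (r\<^sup>2 + 2 * r / s + 2 / s\<^sup>2)) \<longlongrightarrow> 0) at_top"
      using assms by real_asymp
    show "((\<lambda>r. - pi * exp (- s * r) * (r\<^sup>2 + 2 * r / s + 2 / s\<^sup>2)) has_real_derivative
        s * pi * r\<^sup>2 * exp (- s * r)) (at r)" for r
      using assms by (auto intro!: derivative_eq_intros simp: field_simps power2_eq_square)
    show "0 \<le> s * pi * r\<^sup>2 * exp (- s * r)" for r
      using assms by simp
  qed auto
  finally show ?thesis by simp
qed

section \<open>The uniform distribution on the unit square\<close>

abbreviation (input) unit_square :: "(real ^ 2) measure" where
  "unit_square \<equiv> uniform_measure lborel (cbox 0 1)"

lemma emeasure_unit_square_cbox: "emeasure lborel (cbox 0 1 :: (real ^ 2) set) = 1"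
  by (subst emeasure_lborel_cbox) (auto simp: Basis_vec_def inner_axis intro!: prod.neutral)

lemma prob_space_unit_square: "prob_space unit_square"
  by (intro prob_space_uniform_measure) (simp_all add: emeasure_unit_square_cbox)

lemma nn_integral_unit_square_le:
  assumes "f \<in> borel_measurable borel"
  shows "(\<integral>\<^sup>+u. f u \<partial>unit_square) \<le> (\<integral>\<^sup>+u. f u \<partial>lborel)"
proof -
  have "(\<integral>\<^sup>+u. f u \<partial>unit_square) = (\<integral>\<^sup>+u. f u * indicator (cbox 0 1) u \<partial>lborel)"
    using assms by (subst nn_integral_uniform_measure)
      (simp_all add: emeasure_unit_square_cbox ennreal_divide_eq_top_iff divide_ennreal_def)
  also have "\<dots> \<le> (\<integral>\<^sup>+u. f u \<partial>lborel)"
    by (intro nn_integral_mono) (auto simp: indicator_def)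
  finally show ?thesis .
qed

text \<open>A disc may stick out of the square, so there is only an inequality. It has the useful
  direction, because \<open>far_prob\<close> decreases in the probability of the disc.\<close>

lemma measure_unit_square_cball_le:
  assumes "r \<ge> 0"
  shows "measure unit_square (cball v r) \<le> pi * r\<^sup>2"
proof -
  have "emeasure unit_square (cball v r) \<le> emeasure lborel (cball v r)"
    using nn_integral_unit_square_le[of "indicator (cball v r)"]
    by (simp add: borel_measurable_indicator)
  also have "\<dots> = ennreal (pi * r\<^sup>2)"
    using assms by (simp add: emeasure_cball unit_ball_vol_2)
  finally show ?thesis
    using assms by (simp add: measure_def enn2real_leI)
qed

section \<open>Counting which of the two nearest neighbours lie beyond a given radius\<close>

text \<open>For \<open>b\<close> with values in \<open>{0, 1}\<close> this is \<open>2 - min 2 (\<Sum>j\<in>J. b j)\<close>; with \<open>b\<close> the indicator of a disc it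
  counts how many of the two nearest neighbours of the centre lie outside the disc. The expanded form
  is chosen because products of independent factors integrate at once.\<close>

definition far_count :: "'i set \<Rightarrow> ('i \<Rightarrow> real) \<Rightarrow> real" where
  "far_count J b = 2 * (\<Prod>j\<in>J. 1 - b j) + (\<Sum>j\<in>J. b j * (\<Prod>l\<in>J - {j}. 1 - b l))"

lemma far_count_nonneg:
  assumes "\<And>j. j \<in> J \<Longrightarrow> b j \<in> {0..1}"
  shows "far_count J b \<ge> 0"
  unfolding far_count_def using assms
  by (intro add_nonneg_nonneg mult_nonneg_nonneg sum_nonneg prod_nonneg) auto

text \<open>No pair of points has fewer members outside the disc than the two nearest neighbours.
  The proof distinguishes whether some point \<open>c\<close> lies inside.\<close>

lemma far_count_le:
  assumes "finite J" and b: "\<And>j. j \<in> J \<Longrightarrow> b j \<in> {0, 1}"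
    and "a \<in> J" "a' \<in> J" "a \<noteq> a'"
  shows "far_count J b \<le> (1 - b a) + (1 - b a')"
proof (cases "\<exists>c\<in>J. b c = 1")
  case False
  then have "b j = 0" if "j \<in> J" for j using b[OF that] that by auto
  then show ?thesis using assms(3,4) by (simp add: far_count_def)
next
  case True
  then obtain c where c: "c \<in> J" "b c = 1" by blast
  define P where "P = (\<Prod>l\<in>J - {c}. 1 - b l)"
  \<comment> \<open>Every product containing the factor of \<open>c\<close> vanishes, so only the
    summand for \<open>c\<close> survives; it is at most any one of its remaining factors.\<close>
  have 0: "(\<Prod>l\<in>J'. 1 - b l) = 0" if "c \<in> J'" "J' \<subseteq> J" for J'
    using that c finite_subset[OF that(2) assms(1)] by (intro prod_zero) auto
  have "(\<Sum>j\<in>J. b j * (\<Prod>l\<in>J - {j}. 1 - b l)) = (\<Sum>j\<in>J. if j = c then P else 0)"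
    using c 0 by (intro sum.cong) (auto simp: P_def)
  then have eq: "far_count J b = P"
    using assms(1) c 0[of J] by (simp add: far_count_def)
  have "P \<le> 1 - b d" if d: "d \<in> J" "d \<noteq> c" for d
  proof -
    have "P = (1 - b d) * (\<Prod>l\<in>J - {c} - {d}. 1 - b l)"
      unfolding P_def using assms(1) d by (subst prod.remove[of _ d]) auto
    also have "\<dots> \<le> (1 - b d) * 1"
      using b d by (intro mult_left_mono prod_le_1) force+
    finally show ?thesis by simp
  qed
  moreover have "0 \<le> 1 - b a" "0 \<le> 1 - b a'" using b assms(3,4) by force+
  ultimately show ?thesis
    using assms(3-5) eq by (cases "a = c") force+
qed

lemma far_count_le_2:
  assumes "finite J" and b: "\<And>j. j \<in> J \<Longrightarrow> b j \<in> {0, 1}"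
  shows "far_count J b \<le> 2"
proof (cases "\<exists>a\<in>J. \<exists>a'\<in>J. a \<noteq> a'")
  case True
  then obtain a a' where a: "a \<in> J" "a' \<in> J" "a \<noteq> a'" by blast
  then have "far_count J b \<le> (1 - b a) + (1 - b a')"
    using assms by (intro far_count_le)
  moreover have "b a \<ge> 0" "b a' \<ge> 0" using b[OF a(1)] b[OF a(2)] by auto
  ultimately show ?thesis by simp
next
  case False
  then have "J = {} \<or> (\<exists>a. J = {a})" by blast
  then show ?thesis using b by (auto simp: far_count_def)
qed

text \<open>The probability that a binomial variable with parameters \<open>m\<close> and \<open>p\<close> vanishes plus the
  probability that it is at most one.\<close>

definition far_prob :: "nat \<Rightarrow> real \<Rightarrow> real" where
  "far_prob m p = 2 * (1 - p) ^ m + m * p * (1 - p) ^ (m - 1)"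

lemma far_prob_antimono:
  assumes "0 \<le> p" "p \<le> q" "q \<le> 1"
  shows "far_prob m q \<le> far_prob m p"
proof (rule DERIV_nonpos_imp_nonincreasing[OF assms(2)])
  fix x assume x: "p \<le> x" "x \<le> q"
  \<comment> \<open>The derivative of the first term is \<open>- 2 * m * (1 - x) ^ (m - 1)\<close>,
    and the product rule on the second gives back only half of it. For \<open>m \<le> 1\<close> the
    truncated exponents do no harm, since the factors \<open>m\<close> or \<open>m - 1\<close>
    vanish.\<close>
  define D where "D = - (real m * (1 - x) ^ (m - 1)) - real m * real (m - 1) * x * (1 - x) ^ (m - 2)"
  have "(far_prob m has_real_derivative D) (at x)"
    unfolding far_prob_def[abs_def] D_def
    by (auto intro!: derivative_eq_intros simp: algebra_simps numeral_2_eq_2)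
  moreover have "D \<le> 0"
  proof -
    have "0 \<le> real m * (1 - x) ^ (m - 1)" "0 \<le> real m * real (m - 1) * x * (1 - x) ^ (m - 2)"
      using assms x by auto
    then show ?thesis unfolding D_def by linarith
  qed
  ultimately show "\<exists>y. (far_prob m has_real_derivative y) (at x) \<and> y \<le> 0" by blast
qed

text \<open>Lowering the exponent by a fixed \<open>k\<close> divides by a \<open>k\<close>-th power
  whose base tends to 1.\<close>

lemma tendsto_power_diff_exp:
  fixes c :: real
  shows "(\<lambda>n. (1 - c / n) ^ (n - k)) \<longlonglongrightarrow> exp (- c)"
proof -
  have lim: "(\<lambda>n. 1 - c / real n) \<longlonglongrightarrow> 1" by real_asymp
  then have "(\<lambda>n. (1 - c / n) ^ n / (1 - c / n) ^ k) \<longlonglongrightarrow> exp (- c) / 1 ^ k"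
    using tendsto_exp_limit_sequentially[of "- c"] by (intro tendsto_intros) auto
  moreover have "\<forall>\<^sub>F n in sequentially. (1 - c / n) ^ n / (1 - c / n) ^ k = (1 - c / n) ^ (n - k)"
    using eventually_ge_at_top[of k] order_tendstoD(1)[OF lim zero_less_one]
  proof eventually_elim
    case (elim n)
    then have "1 - c / n \<noteq> 0" by linarith
    from power_diff[OF this elim(1)] show ?case by simp
  qed
  ultimately show ?thesis
    using Lim_transform_eventually by fastforce
qed

text \<open>Poisson limit with mean \<open>c\<close>: no point in the disc has limiting probability
  \<open>exp (- c)\<close>, at most one point \<open>(1 + c) * exp (- c)\<close>.\<close>

lemma far_prob_limit:
  "(\<lambda>n. far_prob (n - 1) (c / n)) \<longlonglongrightarrow> (2 + c) * exp (- c)"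
proof -
  have "(\<lambda>n. real (n - 1) * (c / n)) \<longlonglongrightarrow> c"
  proof (rule Lim_transform_eventually)
    show "(\<lambda>n. (real n - 1) * (c / n)) \<longlonglongrightarrow> c" by real_asymp
    show "\<forall>\<^sub>F n in sequentially. (real n - 1) * (c / n) = real (n - 1) * (c / n)"
      using eventually_ge_at_top[of 1] by eventually_elim (simp add: of_nat_diff)
  qed
  then have "(\<lambda>n. far_prob (n - 1) (c / n)) \<longlonglongrightarrow> 2 * exp (- c) + c * exp (- c)"
    unfolding far_prob_def diff_diff_left
    by (intro tendsto_add tendsto_mult tendsto_const tendsto_power_diff_exp)
  then show ?thesis by (simp add: algebra_simps)
qed

lemma integral_far_count:
  fixes N :: "'a measure"
  assumes "prob_space N" "A \<in> sets N" "finite J"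
  shows "(\<integral>\<^sup>+z. ennreal (far_count J (\<lambda>j. indicator A (z j))) \<partial>PiM J (\<lambda>_. N))
    = ennreal (far_prob (card J) (measure N A))"
proof -
  interpret N: prob_space N by fact
  interpret P: product_prob_space "\<lambda>_. N" J by standard
  let ?b = "indicator A :: 'a \<Rightarrow> real" and ?p = "measure N A"
  have int: "integrable N ?b" "integrable N (\<lambda>x. 1 - ?b x)"
    using assms(2) by (auto simp: integrable_indicator_iff N.emeasure_eq_measure)
  have p: "(\<integral>x. ?b x \<partial>N) = ?p" "(\<integral>x. 1 - ?b x \<partial>N) = 1 - ?p"
    using assms(2) int by (simp_all add: N.prob_space)
  have a: "integrable (PiM J (\<lambda>_. N)) (\<lambda>z. \<Prod>j\<in>J. 1 - ?b (z j))"
      "(\<integral>z. (\<Prod>j\<in>J. 1 - ?b (z j)) \<partial>PiM J (\<lambda>_. N)) = (1 - ?p) ^ card J"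
    using P.product_integrable_prod[OF assms(3), of "\<lambda>_ x. 1 - ?b x"] int
      P.product_integral_prod[OF assms(3), of "\<lambda>_ x. 1 - ?b x"] p by simp_all
  have c: "integrable (PiM J (\<lambda>_. N)) (\<lambda>z. ?b (z j) * (\<Prod>l\<in>J - {j}. 1 - ?b (z l)))"
      "(\<integral>z. ?b (z j) * (\<Prod>l\<in>J - {j}. 1 - ?b (z l)) \<partial>PiM J (\<lambda>_. N)) = ?p * (1 - ?p) ^ (card J - 1)"
    if j: "j \<in> J" for j
  proof -
    \<comment> \<open>The indicator at \<open>j\<close> and its complement elsewhere form one family
      over all of \<open>J\<close>, to which the product formula applies.\<close>
    let ?f = "\<lambda>l x. if l = j then ?b x else 1 - ?b x"
    have f: "integrable N (?f l)" for l using int by (cases "l = j") auto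
    have eq: "(\<Prod>l\<in>J. ?f l (z l)) = ?b (z j) * (\<Prod>l\<in>J - {j}. 1 - ?b (z l))" for z
      using assms(3) j by (subst prod.remove[of _ j]) (auto intro!: prod.cong)
    show "integrable (PiM J (\<lambda>_. N)) (\<lambda>z. ?b (z j) * (\<Prod>l\<in>J - {j}. 1 - ?b (z l)))"
      using P.product_integrable_prod[OF assms(3), of ?f] f by (simp only: eq)
    have "(\<Prod>l\<in>J. integral\<^sup>L N (?f l)) = integral\<^sup>L N (?f j) * (\<Prod>l\<in>J - {j}. integral\<^sup>L N (?f l))"
      using assms(3) j by (rule prod.remove)
    also have "(\<Prod>l\<in>J - {j}. integral\<^sup>L N (?f l)) = (\<Prod>l\<in>J - {j}. 1 - ?p)"
      using p by (intro prod.cong) auto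
    finally have "(\<Prod>l\<in>J. integral\<^sup>L N (?f l)) = ?p * (1 - ?p) ^ (card J - 1)"
      using p j by simp
    then show "(\<integral>z. ?b (z j) * (\<Prod>l\<in>J - {j}. 1 - ?b (z l)) \<partial>PiM J (\<lambda>_. N)) = ?p * (1 - ?p) ^ (card J - 1)"
      using P.product_integral_prod[OF assms(3), of ?f] f by (simp only: eq)
  qed
  have "(\<integral>\<^sup>+z. ennreal (far_count J (\<lambda>j. ?b (z j))) \<partial>PiM J (\<lambda>_. N)) =
      ennreal (\<integral>z. far_count J (\<lambda>j. ?b (z j)) \<partial>PiM J (\<lambda>_. N))"
    using a c unfolding far_count_def
    by (intro nn_integral_eq_integral AE_I2 far_count_nonneg[unfolded far_count_def]) (auto simp: indicator_def)
  also have "(\<integral>z. far_count J (\<lambda>j. ?b (z j)) \<partial>PiM J (\<lambda>_. N)) = far_prob (card J) ?p"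
    unfolding far_count_def far_prob_def using a c
    by (subst Bochner_Integration.integral_add) (auto simp: Bochner_Integration.integral_sum)
  finally show ?thesis .
qed

text \<open>Fubini fixes the position \<open>y\<close> of point \<open>i\<close>. The other points
  then fall into the disc around \<open>y\<close> independently, each with probability at most
  \<open>q\<close>, and \<open>far_prob\<close> is antitone.\<close>

lemma nn_integral_far_count_ge:
  fixes N :: "'a::{metric_space, second_countable_topology} measure"
  assumes "prob_space N" and [measurable_cong]: "sets N = sets borel" and "finite J" "i \<notin> J"
    and q: "\<And>v. measure N (cball v r) \<le> q" "q \<le> 1"
  shows "(\<integral>\<^sup>+z. ennreal (far_count J (\<lambda>j. indicator {..r} (dist (z i) (z j)))) \<partial>PiM (insert i J) (\<lambda>_. N))
    \<ge> ennreal (far_prob (card J) q)"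
proof -
  interpret N: prob_space N by fact
  interpret P: product_prob_space "\<lambda>_. N" J by standard
  have "ennreal (far_prob (card J) q) = (\<integral>\<^sup>+y. ennreal (far_prob (card J) q) \<partial>N)"
    by (simp add: N.emeasure_space_1)
  also have "\<dots> \<le> (\<integral>\<^sup>+y. ennreal (far_prob (card J) (measure N (cball y r))) \<partial>N)"
    using q by (intro nn_integral_mono ennreal_leI far_prob_antimono) auto
  also have "\<dots> = (\<integral>\<^sup>+y. \<integral>\<^sup>+z. ennreal (far_count J (\<lambda>j. indicator (cball y r) (z j))) \<partial>PiM J (\<lambda>_. N) \<partial>N)"
    using assms by (intro nn_integral_cong) (subst integral_far_count, auto)
  also have "\<dots> = (\<integral>\<^sup>+y. \<integral>\<^sup>+z. ennreal (far_count J (\<lambda>j. indicator {..r} (dist ((z(i := y)) i) ((z(i := y)) j))))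
      \<partial>PiM J (\<lambda>_. N) \<partial>N)"
  proof -
    have "far_count J (\<lambda>j. indicator (cball y r) (z j)) =
        far_count J (\<lambda>j. indicator {..r} (dist ((z(i := y)) i) ((z(i := y)) j)))" for y and z :: "_ \<Rightarrow> 'a"
    proof -
      have "j \<in> J \<Longrightarrow> indicator {..r} (dist ((z(i := y)) i) ((z(i := y)) j)) = (indicator (cball y r) (z j) :: real)" for j
        using assms(4) by (auto simp: indicator_def)
      then show ?thesis by (simp add: far_count_def)
    qed
    then show ?thesis by simp
  qed
  also have "\<dots> = (\<integral>\<^sup>+z. ennreal (far_count J (\<lambda>j. indicator {..r} (dist (z i) (z j)))) \<partial>PiM (insert i J) (\<lambda>_. N))"
    unfolding far_count_def
    by (rule P.product_nn_integral_insert_rev[symmetric]) (use assms(3,4) in measurable)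
  finally show ?thesis .
qed

subsection \<open>The Gaussian integral\<close>

definition gauss_integral :: "real \<Rightarrow> real" where
  "gauss_integral x = integral {0..x} (\<lambda>u. exp (- (pi * u\<^sup>2)))"

text \<open>The half-line integral of \<open>exp (- x\<^sup>2)\<close> is
  \<open>sqrt pi / 2\<close>, and the substitution with factor \<open>sqrt pi\<close> divides it by
  \<open>sqrt pi\<close>.\<close>

lemma gauss_integral_tendsto: "(gauss_integral \<longlongrightarrow> 1 / 2) at_top"
proof -
  let ?f = "\<lambda>u::real. indicator {0..} u *\<^sub>R exp (- (pi * u\<^sup>2)) :: real"
  have "has_bochner_integral lborel (\<lambda>u. indicator {0..} (0 + sqrt pi * u) *\<^sub>R exp (- (0 + sqrt pi * u)\<^sup>2))
      ((sqrt pi / 2) /\<^sub>R \<bar>sqrt pi\<bar>)"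
    using gaussian_moment_0 by (subst lborel_has_bochner_integral_real_affine_iff[symmetric]) auto
  also have "(\<lambda>u. indicator {0..} (0 + sqrt pi * u) *\<^sub>R exp (- (0 + sqrt pi * u)\<^sup>2)) = ?f"
    using pi_gt_zero[unfolded not_le[symmetric]] by (auto simp: fun_eq_iff indicator_def power_mult_distrib zero_le_mult_iff)
  finally have f: "has_bochner_integral lborel ?f (1 / 2)"
    by (simp add: field_simps)
  have "((\<lambda>y. \<integral>u. indicator {..y} u *\<^sub>R ?f u \<partial>lborel) \<longlongrightarrow> (\<integral>u. ?f u \<partial>lborel)) at_top"
    using f by (intro tendsto_integral_at_top) (auto simp: has_bochner_integral_iff)
  moreover have "(\<integral>u. indicator {..y} u *\<^sub>R ?f u \<partial>lborel) = gauss_integral y" for y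
  proof -
    have "(\<integral>u. indicator {..y} u *\<^sub>R ?f u \<partial>lborel) = (LINT u:{0..y}|lborel. exp (- (pi * u\<^sup>2)))"
      unfolding set_lebesgue_integral_def
      by (intro Bochner_Integration.integral_cong) (auto simp: indicator_def)
    also have "\<dots> = gauss_integral y"
      unfolding gauss_integral_def
      by (intro set_borel_integral_eq_integral borel_integrable_atLeastAtMost' continuous_intros)
    finally show ?thesis .
  qed
  ultimately show ?thesis
    unfolding has_bochner_integral_integral_eq[OF f] by simp
qed

lemma gauss_integral_bounds:
  assumes "x \<ge> 0"
  shows "0 \<le> gauss_integral x" "gauss_integral x \<le> x"
proof -
  have int: "(\<lambda>u. exp (- (pi * u\<^sup>2))) integrable_on {0..x}"
    by (intro integrable_continuous_interval continuous_intros)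
  show "0 \<le> gauss_integral x"
    unfolding gauss_integral_def by (intro integral_nonneg int) auto
  have "gauss_integral x \<le> integral {0..x} (\<lambda>_. 1)"
    unfolding gauss_integral_def by (intro integral_le int) auto
  then show "gauss_integral x \<le> x" using assms by simp
qed

lemma DERIV_gauss_integral:
  assumes "x > 0"
  shows "(gauss_integral has_real_derivative exp (- (pi * x\<^sup>2))) (at x)"
proof -
  have "((\<lambda>y. integral {0..y} (\<lambda>u. exp (- (pi * u\<^sup>2)))) has_real_derivative exp (- (pi * x\<^sup>2)))
      (at x within {0..x + 1})"
    using assms by (intro integral_has_real_derivative continuous_intros) auto
  moreover have "at x within {0..x + 1} = at x"
    using assms by (intro at_within_interior) auto
  ultimately show ?thesis by (simp add: gauss_integral_def[abs_def])
qed

section \<open>Riemann sums of the limiting tail function\<close>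

text \<open>A primitive of \<open>(2 + \<pi> u\<^sup>2) exp (- \<pi> u\<^sup>2)\<close>, the limit of the summed tail
  functions of the distances to the two nearest neighbours, rescaled by \<open>sqrt n\<close>.\<close>

definition far_primitive :: "real \<Rightarrow> real" where
  "far_primitive x = 5 / 2 * gauss_integral x - x / 2 * exp (- (pi * x\<^sup>2))"

lemma DERIV_far_primitive:
  assumes "x > 0"
  shows "(far_primitive has_real_derivative (2 + pi * x\<^sup>2) * exp (- (pi * x\<^sup>2))) (at x)"
  unfolding far_primitive_def[abs_def]
  by (auto intro!: derivative_eq_intros DERIV_gauss_integral assms simp: field_simps power2_eq_square)

lemma far_primitive_at_top: "(far_primitive \<longlongrightarrow> 5 / 4) at_top"
proof -
  have "((\<lambda>x. x / 2 * exp (- (pi * x\<^sup>2))) \<longlongrightarrow> 0) at_top"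
    by real_asymp
  \<comment> \<open>The factor \<open>5 / 2\<close> times the half-line Gaussian integral
    \<open>1 / 2\<close> is the constant 5/4 of the first bound.\<close>
  then have "(far_primitive \<longlongrightarrow> 5 / 2 * (1 / 2) - 0) at_top"
    unfolding far_primitive_def[abs_def] by (intro tendsto_intros gauss_integral_tendsto)
  then show ?thesis by simp
qed

lemma far_primitive_at_0: "(far_primitive \<longlongrightarrow> 0) (at_right 0)"
proof -
  have ev: "\<forall>\<^sub>F x in at_right 0. 0 < (x::real)"
    by (simp add: eventually_at_right_less)
  have "(gauss_integral \<longlongrightarrow> 0) (at_right 0)"
    by (rule real_tendsto_sandwich[of "\<lambda>_. 0" _ _ "\<lambda>x. x"])
      (use ev gauss_integral_bounds in \<open>auto elim!: eventually_mono intro: tendsto_ident_at\<close>)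
  moreover have "((\<lambda>x. x / 2 * exp (- (pi * x\<^sup>2))) \<longlongrightarrow> 0) (at_right 0)"
    by real_asymp
  ultimately have "(far_primitive \<longlongrightarrow> 5 / 2 * 0 - 0) (at_right 0)"
    unfolding far_primitive_def[abs_def] by (intro tendsto_intros)
  then show ?thesis by simp
qed

text \<open>The derivative of \<open>far_primitive\<close> is decreasing, so by the mean value
  theorem its value at the left end of a cell bounds the increment over the cell. The first cell,
  from 0 to \<delta>, is left out; its contribution vanishes as \<delta> tends to 0.\<close>

lemma far_primitive_le_riemann_sum:
  fixes J :: nat and \<delta> :: real
  assumes "\<delta> > 0"
  shows "far_primitive (real (Suc J) * \<delta>) - far_primitive \<delta>
    \<le> (\<Sum>q=1..J. \<delta> * ((2 + pi * (q * \<delta>)\<^sup>2) * exp (- (pi * (q * \<delta>)\<^sup>2))))"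
proof (induction J)
  case (Suc J)
  let ?g = "\<lambda>x. (2 + pi * x\<^sup>2) * exp (- (pi * x\<^sup>2))"
  let ?a = "real (Suc J) * \<delta>"
  have mono: "(2 + d) * exp (- d) \<le> (2 + c) * exp (- c)" if "0 \<le> c" "c \<le> d" for c d :: real
  proof -
    have "2 + d \<le> (2 + c) * (1 + (d - c))"
      using mult_nonneg_nonneg[of c "d - c"] that by (simp add: algebra_simps)
    also have "\<dots> \<le> (2 + c) * exp (d - c)"
      using that by (intro mult_left_mono exp_ge_add_one_self) auto
    finally have "(2 + d) * exp (- d) \<le> (2 + c) * exp (d - c) * exp (- d)"
      by (rule mult_right_mono) simp
    then show ?thesis by (simp add: mult.assoc exp_add[symmetric])
  qed
  have "?a > 0" using assms by simp
  then have pos: "x > 0" if "?a \<le> x" for x using that by linarith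
  have "\<exists>z>?a. z < ?a + \<delta> \<and> far_primitive (?a + \<delta>) - far_primitive ?a = (?a + \<delta> - ?a) * ?g z"
    using assms by (intro MVT2 DERIV_far_primitive) (auto simp del: of_nat_Suc intro: pos)
  then obtain z where z: "?a < z" "far_primitive (?a + \<delta>) - far_primitive ?a = \<delta> * ?g z"
    by auto
  have "?g z \<le> ?g ?a"
    using z(1) \<open>?a > 0\<close> by (intro mono mult_left_mono power_mono) auto
  then have "far_primitive (?a + \<delta>) - far_primitive ?a \<le> \<delta> * ?g ?a"
    unfolding z(2) using assms by (intro mult_left_mono) auto
  moreover have "real (Suc (Suc J)) * \<delta> = ?a + \<delta>" by (simp add: algebra_simps)
  ultimately show ?case using Suc.IH by simp
qed simp

subsection \<open>Path lengths under product measures\<close>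

lemma measurable_path_length [measurable]:
  fixes I :: "'i set"
  assumes "set is \<subseteq> I"
  shows "(\<lambda>z. path_length norm (map z is)) \<in> borel_measurable (PiM I (\<lambda>_. borel :: 'a::{second_countable_topology, real_normed_vector} measure))"
proof -
  have "path_length norm (map z is) = (\<Sum>i<length is - 1. norm (z (is ! Suc i) - z (is ! i)))" for z :: "'i \<Rightarrow> 'a"
    by (auto simp: path_length_conv_sum intro!: sum.cong)
  moreover have "(\<lambda>z. norm (z (is ! Suc i) - z (is ! i))) \<in> borel_measurable (PiM I (\<lambda>_. borel :: 'a measure))"
    if "i < length is - 1" for i
  proof -
    have [measurable]: "is ! i \<in> I" "is ! Suc i \<in> I" using that assms by (auto simp: subset_iff)
    show ?thesis by measurable
  qed
  ultimately show ?thesis by simp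
qed

text \<open>Integrating out the start of the path first, each edge contributes one factor.\<close>

lemma nn_integral_exp_path_length_le:
  fixes N :: "'a::{second_countable_topology, real_normed_vector} measure" and I :: "'i set"
  assumes N: "prob_space N" and sets_N [measurable_cong]: "sets N = sets borel"
    and c: "\<And>v. (\<integral>\<^sup>+u. ennreal (exp (- s * norm (v - u))) \<partial>N) \<le> c"
    and "finite I" "set is \<subseteq> I" "distinct is" "is \<noteq> []"
  shows "(\<integral>\<^sup>+z. ennreal (exp (- s * path_length norm (map z is))) \<partial>PiM I (\<lambda>_. N)) \<le> c ^ (length is - 1)"
  using assms(4-)
proof (induction "is" arbitrary: I rule: induct_list012)
  case (2 x)
  interpret prob_space "PiM I (\<lambda>_. N)" using N by (intro prob_space_PiM)
  show ?case by (simp add: emeasure_space_1)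
next
  case (3 x y zs)
  interpret N: prob_space N by fact
  interpret P: product_prob_space "\<lambda>_. N" I by standard
  let ?I = "I - {x}"
  have x: "insert x ?I = I" and y: "y \<in> ?I" and sub: "set (y # zs) \<subseteq> ?I" using "3.prems" by auto
  have [measurable_cong]: "sets (PiM I (\<lambda>_. N)) = sets (PiM I (\<lambda>_. borel))"
    by (intro sets_PiM_cong sets_N refl)
  have [measurable_cong]: "sets (PiM ?I (\<lambda>_. N)) = sets (PiM ?I (\<lambda>_. borel))"
    by (intro sets_PiM_cong sets_N refl)
  have [measurable]: "(\<lambda>z. path_length norm (map z (x # y # zs))) \<in> borel_measurable (PiM I (\<lambda>_. borel :: 'a measure))"
    "(\<lambda>z. path_length norm (map z (y # zs))) \<in> borel_measurable (PiM ?I (\<lambda>_. borel :: 'a measure))"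
    using "3.prems" sub by (intro measurable_path_length; simp)+
  have "(\<lambda>z. ennreal (exp (- s * path_length norm (map z (x # y # zs))))) \<in> borel_measurable (PiM I (\<lambda>_. N))"
    by measurable
  then have "(\<integral>\<^sup>+z. ennreal (exp (- s * path_length norm (map z (x # y # zs)))) \<partial>PiM (insert x ?I) (\<lambda>_. N)) =
      (\<integral>\<^sup>+z. \<integral>\<^sup>+u. ennreal (exp (- s * path_length norm (map (z(x := u)) (x # y # zs)))) \<partial>N \<partial>PiM ?I (\<lambda>_. N))"
    using "3.prems" by (intro P.product_nn_integral_insert) (simp_all only: x finite_Diff, auto)
  then have "(\<integral>\<^sup>+z. ennreal (exp (- s * path_length norm (map z (x # y # zs)))) \<partial>PiM I (\<lambda>_. N)) =
      (\<integral>\<^sup>+z. \<integral>\<^sup>+u. ennreal (exp (- s * path_length norm (map (z(x := u)) (x # y # zs)))) \<partial>N \<partial>PiM ?I (\<lambda>_. N))"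
    by (simp only: x)
  also have "\<dots> = (\<integral>\<^sup>+z. (\<integral>\<^sup>+u. ennreal (exp (- s * norm (z y - u))) \<partial>N) *
      ennreal (exp (- s * path_length norm (map z (y # zs)))) \<partial>PiM ?I (\<lambda>_. N))"
  proof (rule nn_integral_cong)
    fix z :: "'i \<Rightarrow> 'a"
    have eq: "map (z(x := u)) (x # y # zs) = u # z y # map z zs" for u
      using "3.prems" by auto
    have "ennreal (exp (- s * path_length norm (map (z(x := u)) (x # y # zs)))) =
        ennreal (exp (- s * norm (z y - u))) * ennreal (exp (- s * path_length norm (map z (y # zs))))" for u
      by (simp only: eq) (simp add: ennreal_mult'[symmetric] exp_add[symmetric] algebra_simps)
    then show "(\<integral>\<^sup>+u. ennreal (exp (- s * path_length norm (map (z(x := u)) (x # y # zs)))) \<partial>N) =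
        (\<integral>\<^sup>+u. ennreal (exp (- s * norm (z y - u))) \<partial>N) * ennreal (exp (- s * path_length norm (map z (y # zs))))"
      by (simp add: nn_integral_multc)
  qed
  \<comment> \<open>The bound \<open>c\<close> is uniform in the position of the second
    vertex.\<close>
  also have "\<dots> \<le> (\<integral>\<^sup>+z. c * ennreal (exp (- s * path_length norm (map z (y # zs)))) \<partial>PiM ?I (\<lambda>_. N))"
    by (intro nn_integral_mono mult_right_mono c) simp
  also have "\<dots> = c * (\<integral>\<^sup>+z. ennreal (exp (- s * path_length norm (map z (y # zs)))) \<partial>PiM ?I (\<lambda>_. N))"
    by (rule nn_integral_cmult) measurable
  also have "\<dots> \<le> c * c ^ (length (y # zs) - 1)"
    using "3.IH"(2)[of ?I] "3.prems" sub by (intro mult_left_mono) auto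
  finally show ?case by simp
qed simp

section \<open>Independent samples and limits of bounded minorants\<close>

text \<open>Independence and a common law \<open>D\<close> make the joint law of the family a power
  of \<open>D\<close>.\<close>

lemma (in prob_space) nn_integral_indep_vars:
  assumes "indep_vars (\<lambda>_. N) X I" "I \<noteq> {}" "\<And>i. i \<in> I \<Longrightarrow> distr M N (X i) = D"
    and "F \<in> borel_measurable (PiM I (\<lambda>_. N))"
  shows "(\<integral>\<^sup>+\<omega>. F (\<lambda>i\<in>I. X i \<omega>) \<partial>M) = (\<integral>\<^sup>+z. F z \<partial>PiM I (\<lambda>_. D))"
proof -
  have rv: "X i \<in> measurable M N" if "i \<in> I" for i
    using assms(1) that by (auto simp: indep_vars_def)
  have "distr M (\<Pi>\<^sub>M i\<in>I. N) (\<lambda>\<omega>. \<lambda>i\<in>I. X i \<omega>) = (\<Pi>\<^sub>M i\<in>I. distr M N (X i))"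
    using indep_vars_iff_distr_eq_PiM'[OF assms(2), where M' = "\<lambda>_. N" and X = X] rv assms(1) by auto
  also have "\<dots> = PiM I (\<lambda>_. D)"
    using assms(3) by (intro PiM_cong) auto
  finally have eq: "PiM I (\<lambda>_. D) = distr M (\<Pi>\<^sub>M i\<in>I. N) (\<lambda>\<omega>. \<lambda>i\<in>I. X i \<omega>)" ..
  show ?thesis
    unfolding eq using assms(4) rv
    by (subst nn_integral_distr) (auto intro!: measurable_restrict)
qed

text \<open>The majorant \<open>Z\<close> will be the rescaled makespan, whose measurability is never established; hence
  dominated convergence is applied to \<open>max (V n) \<beta>\<close>.\<close>

lemma (in prob_space) le_limit_of_bounded_minorant:
  fixes Z V :: "nat \<Rightarrow> 'a \<Rightarrow> real"
  assumes Z: "AE \<omega> in M. (\<lambda>n. Z n \<omega>) \<longlonglongrightarrow> \<beta>"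
    and VZ: "AE \<omega> in M. \<forall>\<^sub>F n in sequentially. V n \<omega> \<le> Z n \<omega>"
    and [measurable]: "\<And>n. V n \<in> borel_measurable M"
    and V: "\<And>n \<omega>. 0 \<le> V n \<omega>" "\<And>n \<omega>. V n \<omega> \<le> K"
    and e: "\<forall>\<^sub>F n in sequentially. ennreal (e n) \<le> (\<integral>\<^sup>+\<omega>. ennreal (V n \<omega>) \<partial>M)" "e \<longlonglongrightarrow> l"
  shows "l \<le> \<beta>"
proof -
  have int: "integrable M (V n)" for n
    using V by (intro integrable_const_bound[of _ K]) auto
  have "(\<lambda>n. \<integral>\<omega>. max (V n \<omega>) \<beta> \<partial>M) \<longlonglongrightarrow> (\<integral>\<omega>. \<beta> \<partial>M)"
  proof (rule integral_dominated_convergence[where w = "\<lambda>_. max K \<bar>\<beta>\<bar>"])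
    show "AE \<omega> in M. (\<lambda>n. max (V n \<omega>) \<beta>) \<longlonglongrightarrow> \<beta>"
      using Z VZ
    proof eventually_elim
      case (elim \<omega>)
      \<comment> \<open>The sequence is squeezed between the constant \<beta> and
        \<open>max (Z n \<omega>) \<beta>\<close>; \<open>V n \<omega>\<close> itself need not
        converge.\<close>
      have "(\<lambda>n. max (Z n \<omega>) \<beta>) \<longlonglongrightarrow> max \<beta> \<beta>"
        using elim(1) by (intro tendsto_intros)
      moreover have "\<forall>\<^sub>F n in sequentially. max (V n \<omega>) \<beta> \<le> max (Z n \<omega>) \<beta>"
        using elim(2) by eventually_elim auto
      ultimately show ?case
        using real_tendsto_sandwich[of "\<lambda>_. \<beta>" "\<lambda>n. max (V n \<omega>) \<beta>" sequentially
            "\<lambda>n. max (Z n \<omega>) \<beta>" \<beta>] by simp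
    qed
    show "AE \<omega> in M. norm (max (V n \<omega>) \<beta>) \<le> max K \<bar>\<beta>\<bar>" for n
    proof (rule AE_I2)
      show "norm (max (V n \<omega>) \<beta>) \<le> max K \<bar>\<beta>\<bar>" for \<omega>
        using V(1)[of n \<omega>] V(2)[of n \<omega>] by (auto simp: max_def abs_if)
    qed
  qed auto
  then have lim: "(\<lambda>n. \<integral>\<omega>. max (V n \<omega>) \<beta> \<partial>M) \<longlonglongrightarrow> \<beta>" by (simp add: prob_space)
  show ?thesis
  proof (rule tendsto_le[OF _ lim e(2)])
    show "\<forall>\<^sub>F n in sequentially. e n \<le> (\<integral>\<omega>. max (V n \<omega>) \<beta> \<partial>M)"
      using e(1)
    proof eventually_elim
      case (elim n)
      then have "ennreal (e n) \<le> ennreal (\<integral>\<omega>. V n \<omega> \<partial>M)"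
        using V int by (subst (asm) nn_integral_eq_integral) auto
      then have "e n \<le> (\<integral>\<omega>. V n \<omega> \<partial>M)"
        using V by (subst (asm) ennreal_le_iff) (auto intro: integral_nonneg_AE)
      also have "\<dots> \<le> (\<integral>\<omega>. max (V n \<omega>) \<beta> \<partial>M)"
        using int by (intro integral_mono integrable_max) auto
      finally show ?case .
    qed
  qed simp
qed

subsection \<open>The two bounds\<close>

locale uniform_points = prob_space M for M :: "'s measure" +
  fixes X :: "nat \<Rightarrow> 's \<Rightarrow> real ^ 2"
  assumes indep: "indep_vars (\<lambda>_. borel) X UNIV"
    and unif: "\<And>i. distr M borel (X i) = unit_square"
begin

lemma measurable_X [measurable]: "X i \<in> borel_measurable M"
  using indep by (auto simp: indep_vars_def)

lemma nn_integral_points: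
  assumes "I \<noteq> {}" "F \<in> borel_measurable (PiM I (\<lambda>_. borel))"
  shows "(\<integral>\<^sup>+\<omega>. F (\<lambda>i\<in>I. X i \<omega>) \<partial>M) = (\<integral>\<^sup>+z. F z \<partial>PiM I (\<lambda>_. unit_square))"
  using assms unif indep_vars_subset[OF indep, of I] by (intro nn_integral_indep_vars) auto

lemma nn_integral_exp_path_le:
  assumes "s > 0" "distinct is" "is \<noteq> []"
  shows "(\<integral>\<^sup>+\<omega>. ennreal (exp (- s * path_length norm (map (\<lambda>i. X i \<omega>) is))) \<partial>M)
    \<le> ennreal ((2 * pi / s\<^sup>2) ^ (length is - 1))"
proof -
  have "(\<integral>\<^sup>+u. ennreal (exp (- s * norm (v - u))) \<partial>unit_square) \<le> ennreal (2 * pi / s\<^sup>2)" for v :: "real ^ 2"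
    using nn_integral_unit_square_le[of "\<lambda>u. ennreal (exp (- s * norm (v - u)))"]
      nn_integral_exp_dist[OF assms(1), of v] by (simp add: dist_norm)
  then have "(\<integral>\<^sup>+z. ennreal (exp (- s * path_length norm (map z is))) \<partial>PiM (set is) (\<lambda>_. unit_square))
      \<le> ennreal (2 * pi / s\<^sup>2) ^ (length is - 1)"
    using assms by (intro nn_integral_exp_path_length_le prob_space_unit_square) auto
  also have "\<dots> = ennreal ((2 * pi / s\<^sup>2) ^ (length is - 1))"
    by (simp add: ennreal_power)
  also have "(\<integral>\<^sup>+z. ennreal (exp (- s * path_length norm (map z is))) \<partial>PiM (set is) (\<lambda>_. unit_square)) =
      (\<integral>\<^sup>+\<omega>. ennreal (exp (- s * path_length norm (map (\<lambda>i\<in>set is. X i \<omega>) is))) \<partial>M)"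
    using assms(3) by (intro nn_integral_points[symmetric] measurable_compose[OF measurable_path_length[OF order_refl]]) auto
  also have "\<dots> = (\<integral>\<^sup>+\<omega>. ennreal (exp (- s * path_length norm (map (\<lambda>i. X i \<omega>) is))) \<partial>M)"
  proof -
    have "map (\<lambda>i\<in>set is. X i \<omega>) is = map (\<lambda>i. X i \<omega>) is" for \<omega> by simp
    then show ?thesis by (simp only:)
  qed
  finally show ?thesis .
qed

text \<open>Where two points coincide, the path between them has weight 1. So this event has
  probability at most \<open>2 * pi / s\<^sup>2\<close> for every positive \<open>s\<close>, and
  \<open>s\<close> tends to infinity.\<close>

lemma AE_inj: "AE \<omega> in M. inj (\<lambda>i. X i \<omega>)"
proof -
  have "AE \<omega> in M. X i \<omega> \<noteq> X j \<omega>" if "i \<noteq> j" for i j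
  proof -
    let ?A = "{\<omega> \<in> space M. X i \<omega> = X j \<omega>}"
    have A: "?A \<in> sets M" by measurable
    have "measure M ?A \<le> 2 * pi / s\<^sup>2" if "s > 0" for s
    proof -
      have "emeasure M ?A = (\<integral>\<^sup>+\<omega>. indicator ?A \<omega> \<partial>M)" using A by simp
      also have "\<dots> \<le> (\<integral>\<^sup>+\<omega>. ennreal (exp (- s * path_length norm (map (\<lambda>i. X i \<omega>) [i, j]))) \<partial>M)"
        by (intro nn_integral_mono) (auto simp: indicator_def)
      also have "\<dots> \<le> ennreal ((2 * pi / s\<^sup>2) ^ (length [i, j] - 1))"
        using that \<open>i \<noteq> j\<close> by (intro nn_integral_exp_path_le) auto
      finally show ?thesis
        by (simp add: emeasure_eq_measure)
    qed
    then have "measure M ?A \<le> 0"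
      by (intro tendsto_lowerbound[of "\<lambda>s. 2 * pi / s\<^sup>2" 0 at_top])
        (real_asymp, auto intro: eventually_mono[OF eventually_gt_at_top[of 0]])
    then have "emeasure M ?A = 0"
      by (simp add: emeasure_eq_measure measure_le_0_iff)
    then show ?thesis
      using A by (subst AE_iff_measurable[of ?A]) auto
  qed
  then have "AE \<omega> in M. \<forall>i j. i \<noteq> j \<longrightarrow> X i \<omega> \<noteq> X j \<omega>"
    by (simp add: AE_all_countable AE_impI)
  then show ?thesis
    by eventually_elim (auto simp: inj_def)
qed

section \<open>The bound from nearest neighbours\<close>

definition far :: "nat \<Rightarrow> real \<Rightarrow> nat \<Rightarrow> 's \<Rightarrow> real" where
  "far n r i \<omega> = far_count ({..<n} - {i}) (\<lambda>j. indicator {..r} (dist (X i \<omega>) (X j \<omega>)))"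

lemma measurable_far [measurable]: "far n r i \<in> borel_measurable M"
  unfolding far_def far_count_def by measurable

lemma far_bounds: "0 \<le> far n r i \<omega>" "far n r i \<omega> \<le> 2"
  unfolding far_def by (intro far_count_nonneg far_count_le_2; auto simp: indicator_def)+

lemma nn_integral_far_ge:
  assumes "i < n" "r \<ge> 0" "pi * r\<^sup>2 \<le> 1"
  shows "ennreal (far_prob (n - 1) (pi * r\<^sup>2)) \<le> (\<integral>\<^sup>+\<omega>. ennreal (far n r i \<omega>) \<partial>M)"
proof -
  let ?J = "{..<n} - {i}"
  let ?F = "\<lambda>z. ennreal (far_count ?J (\<lambda>j. indicator {..r} (dist (z i) (z j :: real ^ 2))))"
  have ins: "insert i ?J = {..<n}" using assms(1) by auto
  have comp: "(\<lambda>z. indicator {..r} (dist (z i) (z j)) :: real) \<in> borel_measurable (PiM {..<n} (\<lambda>_. borel :: (real ^ 2) measure))"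
    if "j < n" for j
  proof -
    have [measurable]: "i \<in> {..<n}" "j \<in> {..<n}" using assms(1) that by auto
    show ?thesis by measurable
  qed
  have "ennreal (far_prob (card ?J) (pi * r\<^sup>2)) \<le> (\<integral>\<^sup>+z. ?F z \<partial>PiM (insert i ?J) (\<lambda>_. unit_square))"
    using assms by (intro nn_integral_far_count_ge prob_space_unit_square measure_unit_square_cball_le) auto
  also have "\<dots> = (\<integral>\<^sup>+z. ?F z \<partial>PiM {..<n} (\<lambda>_. unit_square))"
    by (simp only: ins)
  also have "\<dots> = (\<integral>\<^sup>+\<omega>. ?F (\<lambda>i\<in>{..<n}. X i \<omega>) \<partial>M)"
  proof (rule nn_integral_points[symmetric])
    show "?F \<in> borel_measurable (PiM {..<n} (\<lambda>_. borel))"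
      unfolding far_count_def
      by (intro measurable_compose[OF _ measurable_ennreal] borel_measurable_add borel_measurable_times
          borel_measurable_const borel_measurable_sum borel_measurable_prod borel_measurable_diff comp) auto
  qed (use assms(1) in auto)
  also have "\<dots> = (\<integral>\<^sup>+\<omega>. ennreal (far n r i \<omega>) \<partial>M)"
    using assms(1) by (intro nn_integral_cong) (simp add: far_def far_count_def)
  finally show ?thesis using assms(1) by simp
qed

text \<open>Summed over radii with step \<open>\<delta> / sqrt n\<close>, the indicators that a
  distance exceeds the radius stay below the distance. The summed counts can therefore play the role
  of \<psi> in \<open>euclidean_TSPD_ge_neighbour_sum\<close>; dividing by \<open>sqrt n\<close>
  produces the weight \<open>\<delta> / n\<close>.\<close>

lemma far_sum_le_TSPD:
  fixes J :: nat and \<delta> :: real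
  assumes "\<alpha> > 0" "\<delta> > 0" "n \<ge> 5" and inj: "inj (\<lambda>i. X i \<omega>)"
  shows "(\<Sum>i<n. \<Sum>q=1..J. \<delta> / n * far n (q * \<delta> / sqrt n) i \<omega>)
    \<le> (\<alpha> + 2) * (euclidean_TSPD \<alpha> ((\<lambda>i. X i \<omega>) ` {..<n}) / sqrt n)"
proof -
  let ?x = "\<lambda>i. X i \<omega>"
  define \<psi> where "\<psi> i = (\<Sum>q=1..J. \<delta> / sqrt n * far n (q * \<delta> / sqrt n) i \<omega>)" for i
  have n: "sqrt n > 0" using assms(3) by simp
  \<comment> \<open>The neighbour bound needs a function of points, while \<psi> depends on indices;
    the inverse translates.\<close>
  have inv: "inv ?x (?x i) = i" for i using inv_f_f[OF inj, of i] by simp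
  \<comment> \<open>This is \<delta> times the number of grid points below \<open>y\<close>. The
    minimum with \<open>J * \<delta>\<close> is what lets the induction go through.\<close>
  have count: "(\<Sum>q=1..J. \<delta> * (1 - indicator {..q * \<delta>} y)) \<le> min y (J * \<delta>)" if "y \<ge> 0" for y :: real and J :: nat
  proof (induction J)
    case (Suc J)
    then show ?case using assms(2) by (cases "y \<le> Suc J * \<delta>") (auto simp: indicator_def algebra_simps)
  qed (use that in auto)
  have edge: "(\<Sum>q=1..J. \<delta> / sqrt n * (1 - indicator {..q * \<delta> / sqrt n} (dist (?x i) (?x a)))) \<le> norm (?x a - ?x i)" for i a
  proof -
    have "(\<Sum>q=1..J. \<delta> / sqrt n * (1 - indicator {..q * \<delta> / sqrt n} (dist (?x i) (?x a)))) =
        (\<Sum>q=1..J. \<delta> * (1 - indicator {..q * \<delta>} (dist (?x i) (?x a) * sqrt n))) / sqrt n"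
      using n by (auto simp: sum_divide_distrib indicator_def field_simps intro!: sum.cong)
    also have "\<dots> \<le> dist (?x i) (?x a) * sqrt n / sqrt n"
      using n count[of "dist (?x i) (?x a) * sqrt n" J] by (intro divide_right_mono) auto
    finally show ?thesis using n by (simp add: dist_norm norm_minus_commute)
  qed
  have "sum (\<lambda>v. \<psi> (inv ?x v)) (?x ` {..<n}) \<le> (\<alpha> + 2) * euclidean_TSPD \<alpha> (?x ` {..<n})"
  proof (rule euclidean_TSPD_ge_neighbour_sum)
    show "card (?x ` {..<n}) \<ge> 5"
      using assms(3) inj by (subst card_image) (auto intro: inj_on_subset)
    fix v a b assume "{v, a, b} \<subseteq> ?x ` {..<n}" "distinct [v, a, b]"
    then obtain i j k where ijk: "v = ?x i" "a = ?x j" "b = ?x k" "i < n" "j \<in> {..<n} - {i}" "k \<in> {..<n} - {i}" "j \<noteq> k"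
      by auto
    have "\<psi> i \<le> (\<Sum>q=1..J. \<delta> / sqrt n * ((1 - indicator {..q * \<delta> / sqrt n} (dist (?x i) (?x j))) +
        (1 - indicator {..q * \<delta> / sqrt n} (dist (?x i) (?x k)))))"
      unfolding \<psi>_def far_def using ijk n assms(2)
      by (intro sum_mono mult_left_mono far_count_le) (auto simp: indicator_def)
    also have "\<dots> \<le> norm (?x j - ?x i) + norm (?x k - ?x i)"
      using add_mono[OF edge[of i j] edge[of i k]] by (simp only: distrib_left sum.distrib)
    finally show "\<psi> (inv ?x v) \<le> norm (a - v) + norm (b - v)"
      using ijk inv by simp
  qed (use assms in auto)
  also have "sum (\<lambda>v. \<psi> (inv ?x v)) (?x ` {..<n}) = sum \<psi> {..<n}"
    using inj by (subst sum.reindex) (auto simp: inv intro: inj_on_subset)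
  finally have "sum \<psi> {..<n} / sqrt n \<le> (\<alpha> + 2) * euclidean_TSPD \<alpha> (?x ` {..<n}) / sqrt n"
    using n by (intro divide_right_mono) auto
  moreover have "sum \<psi> {..<n} / sqrt n = (\<Sum>i<n. \<Sum>q=1..J. \<delta> / n * far n (q * \<delta> / sqrt n) i \<omega>)"
    unfolding \<psi>_def sum_divide_distrib by (intro sum.cong refl) (simp add: divide_divide_eq_left mult_ac)
  ultimately show ?thesis by simp
qed

text \<open>For a fixed grid the minorant is bounded, so the limit of its expectation cannot exceed
  the limit of the majorant. At the rescaled radius \<open>q * \<delta>\<close> that expectation is
  governed by the Poisson limit with mean \<open>pi * (q * \<delta>)\<^sup>2\<close>.\<close>

lemma riemann_sum_le_limit:
  fixes J :: nat and \<delta> :: real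
  assumes lim: "AE \<omega> in M. (\<lambda>n. euclidean_TSPD \<alpha> ((\<lambda>i. X i \<omega>) ` {..<n}) / sqrt n) \<longlonglongrightarrow> \<beta>"
    and "\<alpha> > 0" "\<delta> > 0"
  shows "(\<Sum>q=1..J. \<delta> * ((2 + pi * (q * \<delta>)\<^sup>2) * exp (- (pi * (q * \<delta>)\<^sup>2)))) \<le> (\<alpha> + 2) * \<beta>"
proof (rule le_limit_of_bounded_minorant)
  let ?V = "\<lambda>n \<omega>. \<Sum>i<n. \<Sum>q=1..J. \<delta> / n * far n (q * \<delta> / sqrt n) i \<omega>"
  let ?e = "\<lambda>n. \<Sum>q=1..J. \<delta> * far_prob (n - 1) (pi * (q * \<delta>)\<^sup>2 / n)"
  show "AE \<omega> in M. (\<lambda>n. (\<alpha> + 2) * (euclidean_TSPD \<alpha> ((\<lambda>i. X i \<omega>) ` {..<n}) / sqrt n)) \<longlonglongrightarrow> (\<alpha> + 2) * \<beta>"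
    using lim by eventually_elim (intro tendsto_intros)
  show "AE \<omega> in M. \<forall>\<^sub>F n in sequentially. ?V n \<omega> \<le> (\<alpha> + 2) * (euclidean_TSPD \<alpha> ((\<lambda>i. X i \<omega>) ` {..<n}) / sqrt n)"
    using AE_inj
  proof eventually_elim
    case (elim \<omega>)
    then show ?case
      using assms(2,3) by (intro eventually_mono[OF eventually_ge_at_top[of 5]] far_sum_le_TSPD)
  qed
  show "?V n \<in> borel_measurable M" for n by measurable
  show "0 \<le> ?V n \<omega>" for n \<omega>
    using assms(3) far_bounds by (intro sum_nonneg mult_nonneg_nonneg) auto
  show "?V n \<omega> \<le> 2 * \<delta> * J" for n \<omega>
  proof -
    have "?V n \<omega> \<le> (\<Sum>i<n. \<Sum>q=1..J. \<delta> / n * 2)"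
      using assms(3) far_bounds by (intro sum_mono mult_left_mono) auto
    also have "\<dots> \<le> 2 * \<delta> * J" using assms(3) by simp
    finally show ?thesis .
  qed
  show "?e \<longlonglongrightarrow> (\<Sum>q=1..J. \<delta> * ((2 + pi * (q * \<delta>)\<^sup>2) * exp (- (pi * (q * \<delta>)\<^sup>2))))"
    by (intro tendsto_sum tendsto_mult_left far_prob_limit)
  \<comment> \<open>From then on even the largest disc has area at most 1, as
    \<open>nn_integral_far_ge\<close> requires.\<close>
  have "\<forall>\<^sub>F n in sequentially. pi * (J * \<delta>)\<^sup>2 \<le> real n"
    using filterlim_real_sequentially by (auto simp: filterlim_at_top)
  then show "\<forall>\<^sub>F n in sequentially. ennreal (?e n) \<le> (\<integral>\<^sup>+\<omega>. ennreal (?V n \<omega>) \<partial>M)"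
    using eventually_gt_at_top[of 0]
  proof eventually_elim
    case (elim n)
    let ?r = "\<lambda>q. q * \<delta> / sqrt n"
    have r: "pi * (?r q)\<^sup>2 = pi * (q * \<delta>)\<^sup>2 / n" for q :: nat
      by (simp add: power_divide)
    have small: "pi * (?r q)\<^sup>2 \<le> 1" if "q \<le> J" for q
    proof -
      have "pi * (q * \<delta>)\<^sup>2 \<le> pi * (J * \<delta>)\<^sup>2"
        using that assms(3) by (intro mult_left_mono power_mono mult_right_mono) auto
      then have "pi * (q * \<delta>)\<^sup>2 \<le> n" using elim(1) by linarith
      then show ?thesis using elim(2) unfolding r by simp
    qed
    have nonneg: "0 \<le> far_prob (n - 1) (pi * (?r q)\<^sup>2)" if "q \<le> J" for q
      unfolding far_prob_def using small[OF that] by (intro add_nonneg_nonneg mult_nonneg_nonneg) auto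
    \<comment> \<open>Stated for a general nonnegative \<open>a\<close>, because it is applied both
      to the probabilities and to the random counts.\<close>
    have split: "ennreal (\<Sum>i<n. \<Sum>q=1..J. \<delta> / n * a i q) = (\<Sum>i<n. \<Sum>q=1..J. ennreal (\<delta> / n) * ennreal (a i q))"
      if a: "\<And>i q. q \<le> J \<Longrightarrow> 0 \<le> a i q" for a :: "nat \<Rightarrow> nat \<Rightarrow> real"
    proof -
      have "ennreal (\<Sum>i<n. \<Sum>q=1..J. \<delta> / n * a i q) = (\<Sum>i<n. ennreal (\<Sum>q=1..J. \<delta> / n * a i q))"
        using assms(3) a by (intro sum_ennreal[symmetric] sum_nonneg mult_nonneg_nonneg) auto
      also have "\<dots> = (\<Sum>i<n. \<Sum>q=1..J. ennreal (\<delta> / n * a i q))"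
        using assms(3) a by (intro sum.cong refl sum_ennreal[symmetric] mult_nonneg_nonneg) auto
      also have "\<dots> = (\<Sum>i<n. \<Sum>q=1..J. ennreal (\<delta> / n) * ennreal (a i q))"
        using assms(3) by (intro sum.cong refl ennreal_mult') auto
      finally show ?thesis .
    qed
    have "?e n = (\<Sum>i<n. \<Sum>q=1..J. \<delta> / n * far_prob (n - 1) (pi * (?r q)\<^sup>2))"
      unfolding r using elim by (simp add: sum_distrib_left)
    also have "ennreal \<dots> = (\<Sum>i<n. \<Sum>q=1..J. ennreal (\<delta> / n) * ennreal (far_prob (n - 1) (pi * (?r q)\<^sup>2)))"
      using nonneg by (intro split)
    also have "\<dots> \<le> (\<Sum>i<n. \<Sum>q=1..J. ennreal (\<delta> / n) * (\<integral>\<^sup>+\<omega>. ennreal (far n (?r q) i \<omega>) \<partial>M))"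
      using assms(3) small by (intro sum_mono mult_left_mono nn_integral_far_ge) auto
    also have "\<dots> = (\<Sum>i<n. \<Sum>q=1..J. (\<integral>\<^sup>+\<omega>. ennreal (\<delta> / n) * ennreal (far n (?r q) i \<omega>) \<partial>M))"
      by (intro sum.cong refl nn_integral_cmult[symmetric]) measurable
    also have "\<dots> = (\<integral>\<^sup>+\<omega>. (\<Sum>i<n. \<Sum>q=1..J. ennreal (\<delta> / n) * ennreal (far n (?r q) i \<omega>)) \<partial>M)"
      by (simp add: nn_integral_sum)
    also have "\<dots> = (\<integral>\<^sup>+\<omega>. ennreal (?V n \<omega>) \<partial>M)"
      using far_bounds by (intro nn_integral_cong split[symmetric])
    finally show ?case .
  qed
qed

text \<open>Three limits in order: \<open>n\<close> is already sent to infinity, then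
  \<open>J\<close> makes the grid exhaust the half-line, and finally \<delta> tends to 0 to remove
  the omitted first cell.\<close>

lemma neighbour_bound:
  assumes lim: "AE \<omega> in M. (\<lambda>n. euclidean_TSPD \<alpha> ((\<lambda>i. X i \<omega>) ` {..<n}) / sqrt n) \<longlonglongrightarrow> \<beta>"
    and "\<alpha> > 0"
  shows "5 / (4 * (\<alpha> + 2)) \<le> \<beta>"
proof -
  have "5 / 4 - far_primitive \<delta> \<le> (\<alpha> + 2) * \<beta>" if "\<delta> > 0" for \<delta>
  proof (rule tendsto_upperbound)
    have "filterlim (\<lambda>J. real (Suc J) * \<delta>) at_top sequentially"
      using that by real_asymp
    then show "(\<lambda>J. far_primitive (real (Suc J) * \<delta>) - far_primitive \<delta>) \<longlonglongrightarrow> 5 / 4 - far_primitive \<delta>"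
      by (intro tendsto_intros filterlim_compose[OF far_primitive_at_top])
    show "\<forall>\<^sub>F J in sequentially. far_primitive (real (Suc J) * \<delta>) - far_primitive \<delta> \<le> (\<alpha> + 2) * \<beta>"
      using far_primitive_le_riemann_sum[OF that] riemann_sum_le_limit[OF lim assms(2) that]
      by (intro always_eventually allI) (rule order_trans)
  qed simp
  then have "\<forall>\<^sub>F \<delta> in at_right 0. 5 / 4 - far_primitive \<delta> \<le> (\<alpha> + 2) * \<beta>"
    by (intro eventually_mono[OF eventually_at_right_less]) auto
  moreover have "((\<lambda>\<delta>. 5 / 4 - far_primitive \<delta>) \<longlongrightarrow> 5 / 4 - 0) (at_right 0)"
    by (intro tendsto_intros far_primitive_at_0)
  ultimately have "5 / 4 - 0 \<le> (\<alpha> + 2) * \<beta>"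
    by (intro tendsto_upperbound) auto
  then show ?thesis using assms(2) by (simp add: field_simps)
qed

section \<open>The bound from paths through half of the points\<close>

text \<open>An exponential moment over all ordered choices of \<open>k\<close> points: it dominates
  \<open>exp (- s \<cdot> L)\<close> for the length \<open>L\<close> of the shortest path through \<open>k\<close> of the points.\<close>

definition path_weight :: "real \<Rightarrow> nat \<Rightarrow> nat \<Rightarrow> 's \<Rightarrow> real" where
  "path_weight s n k \<omega> = (\<Sum>is | distinct is \<and> length is = k \<and> set is \<subseteq> {..<n}.
     exp (- s * path_length norm (map (\<lambda>i. X i \<omega>) is)))"

lemma measurable_points_path_length [measurable]:
  "(\<lambda>\<omega>. path_length norm (map (\<lambda>i. X i \<omega>) is)) \<in> borel_measurable M"
proof -
  have "(\<lambda>\<omega>. path_length norm (map (\<lambda>i\<in>set is. X i \<omega>) is)) \<in> borel_measurable M"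
    by (rule measurable_compose[OF measurable_restrict measurable_path_length]) auto
  then show ?thesis by (simp cong: map_cong)
qed

lemma measurable_path_weight [measurable]: "path_weight s n k \<in> borel_measurable M"
  unfolding path_weight_def by measurable

lemma path_weight_nonneg: "path_weight s n k \<omega> \<ge> 0"
  unfolding path_weight_def by (intro sum_nonneg) simp

text \<open>There are at most \<open>n ^ k\<close> ordered choices, and each path has
  \<open>k - 1\<close> edges.\<close>

lemma nn_integral_path_weight_le:
  assumes "s > 0" "k > 0"
  shows "(\<integral>\<^sup>+\<omega>. ennreal (path_weight s n k \<omega>) \<partial>M) \<le> ennreal (real n ^ k * (2 * pi / s\<^sup>2) ^ (k - 1))"
proof -
  let ?L = "{is. distinct is \<and> length is = k \<and> set is \<subseteq> {..<n}}"
  have sub: "?L \<subseteq> {is. set is \<subseteq> {..<n} \<and> length is = k}" by auto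
  have "card ?L \<le> n ^ k"
    using card_mono[OF finite_lists_length_eq sub] card_lists_length_eq[of "{..<n}" k] by simp
  then have card: "real (card ?L) \<le> real n ^ k"
    by (metis of_nat_le_iff of_nat_power)
  have "(\<integral>\<^sup>+\<omega>. ennreal (path_weight s n k \<omega>) \<partial>M) =
      (\<Sum>is\<in>?L. \<integral>\<^sup>+\<omega>. ennreal (exp (- s * path_length norm (map (\<lambda>i. X i \<omega>) is))) \<partial>M)"
    unfolding path_weight_def by (subst nn_integral_sum[symmetric]) (auto simp: sum_ennreal)
  also have "\<dots> \<le> (\<Sum>is\<in>?L. ennreal ((2 * pi / s\<^sup>2) ^ (k - 1)))"
  proof (rule sum_mono)
    fix "is" assume "is \<in> ?L"
    then show "(\<integral>\<^sup>+\<omega>. ennreal (exp (- s * path_length norm (map (\<lambda>i. X i \<omega>) is))) \<partial>M) \<le> ennreal ((2 * pi / s\<^sup>2) ^ (k - 1))"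
      using nn_integral_exp_path_le[OF assms(1), of "is"] assms(2) by auto
  qed
  also have "\<dots> = ennreal (real (card ?L) * (2 * pi / s\<^sup>2) ^ (k - 1))"
    by (simp add: ennreal_mult ennreal_of_nat_eq_real_of_nat)
  also have "\<dots> \<le> ennreal (real n ^ k * (2 * pi / s\<^sup>2) ^ (k - 1))"
    using card by (intro ennreal_leI mult_right_mono) auto
  finally show ?thesis .
qed

text \<open>The path through \<open>k\<close> points extracted from an optimal solution is one of
  the paths in the sum.\<close>

lemma path_weight_ge:
  assumes "n \<ge> 2" "2 * k \<le> Suc n" "s \<ge> 0" "inj (\<lambda>i. X i \<omega>)"
  shows "exp (- s * euclidean_TSPD \<alpha> ((\<lambda>i. X i \<omega>) ` {..<n})) \<le> path_weight s n k \<omega>"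
proof -
  let ?x = "\<lambda>i. X i \<omega>"
  let ?L = "{is. distinct is \<and> length is = k \<and> set is \<subseteq> {..<n}}"
  have card: "card (?x ` {..<n}) = n"
    using assms(4) by (subst card_image) (auto intro: inj_on_subset)
  obtain p where p: "distinct p" "length p = k" "set p \<subseteq> ?x ` {..<n}"
    "path_length norm p \<le> euclidean_TSPD \<alpha> (?x ` {..<n})"
    unfolding euclidean_TSPD_def
    by (rule TSPD_ge_half_path[of "?x ` {..<n}" k norm "\<lambda>p. norm p / \<alpha>"])
      (use assms card in auto)
  define "is" where "is = map (inv ?x) p"
  have px: "map ?x is = p"
    unfolding is_def map_map
  proof (rule map_idI)
    fix y assume "y \<in> set p"
    then show "(?x \<circ> inv ?x) y = y" using p(3) f_inv_into_f[of y ?x UNIV] by auto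
  qed
  have "is \<in> ?L"
  proof -
    have "distinct is" using p(1) px distinct_map by metis
    moreover have "set is \<subseteq> {..<n}"
      using image_mono[OF p(3), of "inv ?x"] image_inv_f_f[OF assms(4), of "{..<n}"] by (simp add: is_def)
    ultimately show ?thesis using p(2) by (simp add: is_def)
  qed
  moreover have "finite ?L"
    by (rule finite_subset[OF _ finite_lists_length_eq[of "{..<n}" k]]) auto
  ultimately have "exp (- s * path_length norm (map ?x is)) \<le> path_weight s n k \<omega>"
    unfolding path_weight_def by (intro member_le_sum) auto
  moreover have "exp (- s * euclidean_TSPD \<alpha> (?x ` {..<n})) \<le> exp (- s * path_length norm (map ?x is))"
    using p(4) assms(3) by (simp add: px mult_left_mono)
  ultimately show ?thesis by linarith
qed

text \<open>If \<beta> were below some \<open>c < 1 / \<mu>\<close>, the rescaled makespan would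
  almost surely be eventually below \<open>c\<close>, but the first moment of
  \<open>path_weight\<close> makes this ever less likely. The contradiction \<open>1 \<le> 0\<close>
  comes from a minorant with expectation tending to 1 and a majorant tending to 0.\<close>

lemma truck_bound:
  assumes lim: "AE \<omega> in M. (\<lambda>n. euclidean_TSPD \<alpha> ((\<lambda>i. X i \<omega>) ` {..<n}) / sqrt n) \<longlonglongrightarrow> \<beta>"
  shows "1 / (exp 1 * sqrt (2 * pi)) \<le> \<beta>"
proof (rule ccontr)
  \<comment> \<open>For \<open>s = \<lambda> * sqrt n\<close> and \<open>k\<close> near
    \<open>n / 2\<close>, the moment bound has exponential rate
    \<open>\<lambda> * c - ln (\<lambda> / sqrt (2 * pi))\<close>. It is negative for the widest
    range of \<open>c\<close> when the logarithm equals 1, which gives this \<mu>.\<close>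
  define \<mu> where "\<mu> = exp 1 * sqrt (2 * pi)"
  have \<mu>: "\<mu> > 0" "\<mu>\<^sup>2 = 2 * pi * exp 2"
    by (simp_all add: \<mu>_def power_mult_distrib exp_double[symmetric])
  assume "\<not> 1 / (exp 1 * sqrt (2 * pi)) \<le> \<beta>"
  then have "\<beta> < 1 / \<mu>" by (simp add: \<mu>_def)
  then obtain c where c: "\<beta> < c" "c < 1 / \<mu>" using dense by blast
  define t where "t = 1 - \<mu> * c"
  have t: "t > 0" using c(2) \<mu>(1) by (simp add: t_def field_simps)
  let ?Z = "\<lambda>n \<omega>. euclidean_TSPD \<alpha> ((\<lambda>i. X i \<omega>) ` {..<n}) / sqrt n"
  let ?W = "\<lambda>n. path_weight (\<mu> * sqrt n) n (Suc n div 2)"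
  \<comment> \<open>It vanishes where the rescaled makespan is at most \<open>c\<close>; elsewhere
    it is at most 1, and there the majorant
    \<open>\<bar>?Z n \<omega> - \<beta>\<bar> / (c - \<beta>)\<close> is at least 1.\<close>
  let ?U = "\<lambda>n \<omega>. 1 - min 1 (exp (\<mu> * c * n) * ?W n \<omega>)"
  have "1 \<le> (0 :: real)"
  proof (rule le_limit_of_bounded_minorant)
    show "AE \<omega> in M. (\<lambda>n. \<bar>?Z n \<omega> - \<beta>\<bar> / (c - \<beta>)) \<longlonglongrightarrow> 0"
      using lim
    proof eventually_elim
      case (elim \<omega>)
      then have "(\<lambda>n. \<bar>?Z n \<omega> - \<beta>\<bar> / (c - \<beta>)) \<longlonglongrightarrow> \<bar>\<beta> - \<beta>\<bar> / (c - \<beta>)"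
        using c(1) by (intro tendsto_intros) auto
      then show ?case by simp
    qed
    show "AE \<omega> in M. \<forall>\<^sub>F n in sequentially. ?U n \<omega> \<le> \<bar>?Z n \<omega> - \<beta>\<bar> / (c - \<beta>)"
      using AE_inj
    proof eventually_elim
      case (elim \<omega>)
      show ?case
        using eventually_ge_at_top[of 2]
      proof eventually_elim
        case n: (elim n)
        show ?case
        proof (cases "?Z n \<omega> \<le> c")
          case True
          then have "euclidean_TSPD \<alpha> ((\<lambda>i. X i \<omega>) ` {..<n}) \<le> c * sqrt n"
            using n by (simp add: field_simps)
          then have "\<mu> * sqrt n * euclidean_TSPD \<alpha> ((\<lambda>i. X i \<omega>) ` {..<n}) \<le> \<mu> * sqrt n * (c * sqrt n)"
            using \<mu>(1) by (intro mult_left_mono) auto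
          also have "\<dots> = \<mu> * c * n" by simp
          finally have "exp (- (\<mu> * c * n)) \<le> exp (- (\<mu> * sqrt n) * euclidean_TSPD \<alpha> ((\<lambda>i. X i \<omega>) ` {..<n}))"
            by simp
          also have "\<dots> \<le> ?W n \<omega>"
            using n \<mu>(1) elim by (intro path_weight_ge) auto
          finally have "exp (\<mu> * c * n) * exp (- (\<mu> * c * n)) \<le> exp (\<mu> * c * n) * ?W n \<omega>"
            by (intro mult_left_mono) auto
          then have "?U n \<omega> = 0" by (simp add: exp_minus)
          then show ?thesis using c(1) by simp
        next
          case False
          then have "1 \<le> \<bar>?Z n \<omega> - \<beta>\<bar> / (c - \<beta>)" using c(1) by (simp add: field_simps)
          moreover have "?U n \<omega> \<le> 1" using path_weight_nonneg by simp
          ultimately show ?thesis by linarith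
        qed
      qed
    qed
    show "?U n \<in> borel_measurable M" for n by measurable
    show "0 \<le> ?U n \<omega>" for n \<omega> by simp
    show "?U n \<omega> \<le> 1" for n \<omega> using path_weight_nonneg by simp
    show "(\<lambda>n. 1 - real n * exp (2 - t * n)) \<longlonglongrightarrow> 1"
      using t by real_asymp
    show "\<forall>\<^sub>F n in sequentially. ennreal (1 - real n * exp (2 - t * n)) \<le> (\<integral>\<^sup>+\<omega>. ennreal (?U n \<omega>) \<partial>M)"
      using eventually_gt_at_top[of 0]
    proof eventually_elim
      case (elim n)
      define k where "k = Suc n div 2"
      have k: "k > 0" "n \<le> 2 * k" using elim by (auto simp: k_def)
      have "real n ^ k * (2 * pi / (\<mu> * sqrt n)\<^sup>2) ^ (k - 1) = n * exp (- 2 * real (k - 1))"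
      proof -
        have "2 * pi / (\<mu> * sqrt n)\<^sup>2 = exp (- 2) / n"
          using elim by (simp add: power_mult_distrib \<mu>(2) exp_minus field_simps)
        moreover have "real n ^ k = n * real n ^ (k - 1)"
          using k(1) by (cases k) auto
        moreover have "exp (- 2 * real (k - 1)) = exp (- 2) ^ (k - 1)"
          by (subst exp_of_nat2_mult[symmetric]) auto
        ultimately show ?thesis using elim by (simp add: power_divide)
      qed
      \<comment> \<open>Since \<open>n \<le> 2 * k\<close>, the exponent \<open>2 * (k - 1)\<close>
        is at least \<open>n - 2\<close>.\<close>
      also have "\<dots> \<le> n * exp (2 - real n)"
        using k elim by (intro mult_left_mono) (auto simp: of_nat_diff)
      finally have pw: "real n ^ k * (2 * pi / (\<mu> * sqrt n)\<^sup>2) ^ (k - 1) \<le> n * exp (2 - real n)" .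
      let ?y = "real n * exp (2 - t * n)"
      have "(\<integral>\<^sup>+\<omega>. ennreal (exp (\<mu> * c * n) * ?W n \<omega>) \<partial>M) =
          ennreal (exp (\<mu> * c * n)) * (\<integral>\<^sup>+\<omega>. ennreal (?W n \<omega>) \<partial>M)"
        by (simp add: ennreal_mult' nn_integral_cmult)
      also have "\<dots> \<le> ennreal (exp (\<mu> * c * n)) * ennreal (n * exp (2 - real n))"
        using order_trans[OF nn_integral_path_weight_le ennreal_leI[OF pw]] k(1) \<mu>(1) elim
        by (intro mult_left_mono) (auto simp: k_def)
      also have "\<dots> = ennreal ?y"
        by (simp add: ennreal_mult'[symmetric] t_def exp_add[symmetric] algebra_simps mult_exp_exp)
      finally have W: "(\<integral>\<^sup>+\<omega>. ennreal (exp (\<mu> * c * n) * ?W n \<omega>) \<partial>M) \<le> ennreal ?y" .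
      have "1 = (\<integral>\<^sup>+\<omega>. 1 \<partial>M)" by (simp add: emeasure_space_1)
      also have "\<dots> \<le> (\<integral>\<^sup>+\<omega>. ennreal (?U n \<omega>) + ennreal (exp (\<mu> * c * n) * ?W n \<omega>) \<partial>M)"
      proof (rule nn_integral_mono)
        fix \<omega>
        have "1 \<le> ?U n \<omega> + exp (\<mu> * c * n) * ?W n \<omega>" by simp
        then have "ennreal 1 \<le> ennreal (?U n \<omega> + exp (\<mu> * c * n) * ?W n \<omega>)"
          by (rule ennreal_leI)
        then show "1 \<le> ennreal (?U n \<omega>) + ennreal (exp (\<mu> * c * n) * ?W n \<omega>)"
          using path_weight_nonneg by (subst (asm) ennreal_plus) auto
      qed
      also have "\<dots> = (\<integral>\<^sup>+\<omega>. ennreal (?U n \<omega>) \<partial>M) + (\<integral>\<^sup>+\<omega>. ennreal (exp (\<mu> * c * n) * ?W n \<omega>) \<partial>M)"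
        by (rule nn_integral_add) measurable
      also have "\<dots> \<le> (\<integral>\<^sup>+\<omega>. ennreal (?U n \<omega>) \<partial>M) + ennreal ?y"
        by (intro add_left_mono W)
      finally have "1 - ennreal ?y \<le> (\<integral>\<^sup>+\<omega>. ennreal (?U n \<omega>) \<partial>M)"
        by (simp add: ennreal_minus_le_iff add.commute)
      then show ?case
        using ennreal_minus[of ?y 1] by simp
    qed
  qed
  then show False by simp
qed

end

theorem theorem5:
  fixes \<alpha> \<beta> :: real
    and M :: "'s measure"
    and X :: "nat \<Rightarrow> 's \<Rightarrow> real ^ 2"
  assumes "\<alpha> \<ge> 1"
    and "prob_space M"
    and "prob_space.indep_vars M (\<lambda>_. borel) X UNIV"
    and "\<And>i. distr M borel (X i) = uniform_measure lborel (cbox 0 1)"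
    and "AE \<omega> in M.
           (\<lambda>n. euclidean_TSPD \<alpha> ((\<lambda>i. X i \<omega>) ` {..<n}) / sqrt (real n)) \<longlonglongrightarrow> \<beta>"
    and "(\<lambda>n. (\<integral>\<omega>. euclidean_TSPD \<alpha> ((\<lambda>i. X i \<omega>) ` {..<n}) / sqrt (real n) \<partial>M))
           \<longlonglongrightarrow> \<beta>"
  shows "\<beta> \<ge> max (5 / (4 * (\<alpha> + 2))) (1 / (exp 1 * sqrt (2 * pi)))"
proof -
  interpret uniform_points M X
    using assms(2-4) by (intro uniform_points.intro uniform_points_axioms.intro)
  show ?thesis
    using neighbour_bound[OF assms(5)] truck_bound[OF assms(5)] assms(1) by simp
qed

end
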